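(* Let $k\ge 2$ be an integer and let $\mathcal{C}_{\le 2k}:=\{C_4,C_6,\dots,C_{2k}\}$. Then $$\Omega_k\bigl(\mathrm{ex}(n,\mathcal{C}_{\le 2k})\bigr)\le g(n,K_3,C_{2k})\le O_k\bigl(\mathrm{ex}(n,C_{2k})\bigr),$$ that is, there exist constants $c_k,C_k>0$ and $n_0(k)$, depending only on $k$, such that for all $n\ge n_0(k)$, $$c_k\cdot \mathrm{ex}(n,\mathcal{C}_{\le 2k})\le g(n,K_3,C_{2k})\le C_k\cdot \mathrm{ex}(n,C_{2k}).$$
   Context: Constructor--Blocker game: given graphs $H$ and $F$, two players, Constructor and Blocker, alternately claim one previously unclaimed edge of the complete graph $K_n$, with Constructor moving first. The graph formed by Constructor's edges must remain $F$-free (contain no subgraph isomorphic to $F$, not necessarily induced) throughout the game, so Constructor may not claim an edge that would create a copy of $F$; Blocker plays without restriction. The game ends when all edges are claimed or Constructor has no legal move. Constructor aims to maximize the number of copies of $H$ (subgraphs isomorphic to $H$) in her final graph and Blocker aims to minimize it; $g(n,H,F)$ denotes this number under optimal play by both players. For a family $\mathcal{F}$ of graphs, $\mathrm{ex}(n,\mathcal{F})$ is the maximum number of edges in an $n$-vertex graph containing no member of $\mathcal{F}$ as a subgraph; $\mathrm{ex}(n,F):=\mathrm{ex}(n,\{F\})$. $C_\ell$ is the cycle of length $\ell$ and $K_3$ the triangle. Asymptotic notation is as $n\to\infty$, with implied constants depending on the subscripts. *)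

theory Defs
  imports Complex_Main
begin

text \<open>A finite simple graph is a pair of its vertex set and its set of two-element edges.\<close>

type_synonym 'a graph = "'a set \<times> 'a set set"

abbreviation verts :: "'a graph \<Rightarrow> 'a set" where "verts \<equiv> fst"
abbreviation edges :: "'a graph \<Rightarrow> 'a set set" where "edges \<equiv> snd"

definition simple_graph :: "'a graph \<Rightarrow> bool" where
  "simple_graph G \<longleftrightarrow> finite (verts G) \<and> (\<forall>e\<in>edges G. e \<subseteq> verts G \<and> card e = 2)"

definition subgraph :: "'a graph \<Rightarrow> 'a graph \<Rightarrow> bool" where
  "subgraph S G \<longleftrightarrow> simple_graph S \<and> verts S \<subseteq> verts G \<and> edges S \<subseteq> edges G"

definition isomorphic :: "'a graph \<Rightarrow> 'b graph \<Rightarrow> bool" where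
  "isomorphic G H \<longleftrightarrow>
     (\<exists>f. bij_betw f (verts G) (verts H) \<and> (\<lambda>e. f ` e) ` edges G = edges H)"

text \<open>Copies are unlabelled and not necessarily induced: a copy is a subgraph, not an embedding.\<close>

definition copies :: "'a graph \<Rightarrow> 'b graph \<Rightarrow> 'b graph set" where
  "copies H G = {S. subgraph S G \<and> isomorphic S H}"

definition free_of :: "'a graph \<Rightarrow> 'b graph \<Rightarrow> bool" where
  "free_of F G \<longleftrightarrow> copies F G = {}"

definition complete_graph :: "nat \<Rightarrow> nat graph" where
  "complete_graph n = ({..<n}, {e. e \<subseteq> {..<n} \<and> card e = 2})"

text \<open>This is the cycle of length \<open>l\<close> for \<open>l \<ge> 3\<close>; smaller values of \<open>l\<close> are not used.\<close>

definition cycle_graph :: "nat \<Rightarrow> nat graph" where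
  "cycle_graph l = ({..<l}, {{i, Suc i mod l} | i. i < l})"

definition even_cycles_upto :: "nat \<Rightarrow> nat graph set" where
  "even_cycles_upto k = {cycle_graph (2 * i) | i. 2 \<le> i \<and> i \<le> k}"

text \<open>If every member of the family has an edge, the empty graph qualifies, so the set below
  is nonempty; it is always finite.\<close>

definition ex_num :: "nat \<Rightarrow> 'a graph set \<Rightarrow> nat" where
  "ex_num n \<F> = Max {card E | E. E \<subseteq> edges (complete_graph n) \<and> (\<forall>F\<in>\<F>. free_of F ({..<n}, E))}"

text \<open>In a position of the game on the complete graph with vertex set \<open>{..<n}\<close>, \<open>C\<close> and \<open>B\<close> are
  the sets of edges claimed so far by Constructor and by Blocker.\<close>

datatype player = Constructor | Blocker

definition unclaimed :: "nat \<Rightarrow> nat set set \<Rightarrow> nat set set \<Rightarrow> nat set set" where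
  "unclaimed n C B = edges (complete_graph n) - (C \<union> B)"

definition constructor_moves :: "nat \<Rightarrow> 'f graph \<Rightarrow> nat set set \<Rightarrow> nat set set \<Rightarrow> nat set set" where
  "constructor_moves n F C B = {e \<in> unclaimed n C B. free_of F ({..<n}, insert e C)}"

definition game_over :: "nat \<Rightarrow> 'f graph \<Rightarrow> nat set set \<Rightarrow> nat set set \<Rightarrow> bool" where
  "game_over n F C B \<longleftrightarrow> unclaimed n C B = {} \<or> constructor_moves n F C B = {}"

lemma finite_unclaimed: "finite (unclaimed n C B)"
proof -
  have "unclaimed n C B \<subseteq> Pow {..<n}"
    by (auto simp: unclaimed_def complete_graph_def)
  then show ?thesis
    by (rule finite_subset) simp
qed

lemma card_unclaimed_less:
  assumes "e \<in> unclaimed n C B"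
  shows "card (unclaimed n (insert e C) B) < card (unclaimed n C B)"
    and "card (unclaimed n C (insert e B)) < card (unclaimed n C B)"
proof -
  have "unclaimed n (insert e C) B \<subset> unclaimed n C B"
    and "unclaimed n C (insert e B) \<subset> unclaimed n C B"
    using assms by (auto simp only: unclaimed_def)
  then show "card (unclaimed n (insert e C) B) < card (unclaimed n C B)"
    and "card (unclaimed n C (insert e B)) < card (unclaimed n C B)"
    by (auto intro: psubset_card_mono finite_unclaimed)
qed

text \<open>The value, under optimal play from the given position with the given player to move, of the
  game whose payoff is the number of copies of \<open>H\<close> in Constructor's final graph.\<close>

function game_value ::
  "nat \<Rightarrow> 'h graph \<Rightarrow> 'f graph \<Rightarrow> player \<Rightarrow> nat set set \<Rightarrow> nat set set \<Rightarrow> nat" where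
  "game_value n H F Constructor C B =
     (if game_over n F C B then card (copies H ({..<n}, C))
      else Max ((\<lambda>e. game_value n H F Blocker (insert e C) B) ` constructor_moves n F C B))"
| "game_value n H F Blocker C B =
     (if game_over n F C B then card (copies H ({..<n}, C))
      else Min ((\<lambda>e. game_value n H F Constructor C (insert e B)) ` unclaimed n C B))"
  by pat_completeness auto
termination
  by (relation "measure (\<lambda>(n, H, F, p, C, B). card (unclaimed n C B))")
     (auto simp: constructor_moves_def card_unclaimed_less)

definition g_num :: "nat \<Rightarrow> 'h graph \<Rightarrow> 'f graph \<Rightarrow> nat" where
  "g_num n H F = game_value n H F Constructor {} {}"

end

theory Submission
  imports Defs "HOL-Computational_Algebra.Primes" "HOL-Analysis.Convex"
begin

text \<open>
  \<^emph>\<open>Upper bound.\<close> In a \<open>C\<^sub>2\<^sub>k\<close>-free graph the neighbourhood of a vertex \<open>v\<close> spans no path on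
  \<open>2k - 1\<close> vertices, because \<open>v\<close> would close it to a \<open>C\<^sub>2\<^sub>k\<close>. It therefore spans only
  \<open>O\<^sub>k(deg v)\<close> edges, each of which forms one triangle with \<open>v\<close>, and summing over \<open>v\<close> bounds the
  number of triangles by \<open>O\<^sub>k\<close> of the number of edges (\<open>card_triangles_le\<close>). Constructor's final
  graph is \<open>C\<^sub>2\<^sub>k\<close>-free, whatever the play.

  \<^emph>\<open>Lower bound.\<close> Constructor's basic tool is a pairing strategy: from disjoint pairs of unclaimed
  edges whose union keeps her graph legal she obtains one edge of every pair, while Blocker
  makes at most one move per pair (\<open>pairing\<close>). So if many unclaimed edges would each close a
  triangle of their own, and all of them together are legal, she completes half of those triangles
  (\<open>claim_triangles\<close>). Preparing such a position inside one fixed target graph is hopeless when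
  its triangles contain disjoint pairs of edges, one pair per triangle: Blocker then answers either
  edge of a pair by the other one. She therefore starts with edges
  that are common to many legal targets, and commits herself only afterwards, to a target that
  Blocker has hardly damaged; averaging shows that there is one.

  For \<open>k \<ge> 3\<close> the targets are twin blow-ups. Let \<open>G\<close> be a bipartite graph with parts \<open>A\<close> and \<open>B\<close>
  and no cycle of length at most \<open>2k\<close>. If every \<open>b \<in> B\<close> is replaced by two adjacent vertices, then
  every edge of \<open>G\<close> becomes a triangle, and a \<open>C\<^sub>2\<^sub>k\<close> in the result would project to a closed walk
  of \<open>G\<close>; either this walk contains a short cycle of \<open>G\<close> or it stays at a single \<open>b\<close>, which
  leaves room for cycles of length at most four only (\<open>target_free\<close>). Constructor claims two
  candidate twins for every \<open>b\<close>, then half of the edges between \<open>A\<close> and the first copies, and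
  only then decides which candidate to use (\<open>card_edges_le_g_num\<close>). Suitable graphs \<open>G\<close>
  are a star, if the extremal number is linear in \<open>n\<close>, and otherwise a bipartite piece of an
  extremal graph.

  For \<open>k = 2\<close> a twin blow-up does contain \<open>C\<^sub>4\<close>, but here the extremal number is known to be at
  most \<open>n\<^bsup>3/2\<^esup>\<close> (\<open>card_squared_le_of_C4_free\<close>), so that an explicit construction suffices. Take
  lines and points of the affine plane over a prime field. The common part of all targets is the
  incidence graph; the target with parameter \<open>\<lambda>\<close> joins, on every line of slope \<open>p\<close>, a point with
  abscissa \<open>x\<close> in the left half of the plane to the point with abscissa \<open>x + \<lambda>p\<close>, if that lies in
  the right half. Restricting the slopes to a sum-free set makes each target
  \<open>C\<^sub>4\<close>-free (\<open>graph_free\<close>). Two points of a line, one from each half, are joined for exactly one \<open>\<lambda>\<close>, hence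
  Blocker cannot damage all targets at once (\<open>cube_le_g_num\<close>). A weak form of Bertrand's
  postulate (\<open>prime_between_pow2\<close>) provides fields of the right order of magnitude for every \<open>n\<close>.
\<close>

section \<open>The game and the pairing strategy\<close>

lemma free_of_mono:
  assumes "free_of F (V, E)" "E' \<subseteq> E"
  shows "free_of F (V, E')"
  using assms unfolding free_of_def copies_def subgraph_def by auto

lemma finite_copies:
  assumes "finite V" "finite E"
  shows "finite (copies H (V, E))"
  by (rule finite_subset[of _ "Pow V \<times> Pow E"])
    (use assms in \<open>auto simp: copies_def subgraph_def\<close>)

lemma card_copies_mono:
  assumes "finite V" "finite E'" "E \<subseteq> E'"
  shows "card (copies H (V, E)) \<le> card (copies H (V, E'))"
  using assms by (intro card_mono finite_copies) (auto simp: copies_def subgraph_def)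

lemma finite_edges_complete: "finite (edges (complete_graph n))"
  by (rule finite_subset[of _ "Pow {..<n}"]) (auto simp: complete_graph_def)

lemma edge_in_complete:
  assumes "x < n" "y < n" "x \<noteq> y"
  shows "{x, y} \<in> edges (complete_graph n)"
  using assms by (auto simp: complete_graph_def)

declare game_value.simps [simp del]

lemma constructor_moves_unclaimed: "constructor_moves n F C B \<subseteq> unclaimed n C B"
  by (auto simp: constructor_moves_def)

lemma game_value_over:
  "game_over n F C B \<Longrightarrow> game_value n H F p C B = card (copies H ({..<n}, C))"
  by (cases p) (simp_all add: game_value.simps)

lemma game_value_Constructor:
  "\<not> game_over n F C B \<Longrightarrow> game_value n H F Constructor C B =
     Max ((\<lambda>e. game_value n H F Blocker (insert e C) B) ` constructor_moves n F C B)"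
  by (subst game_value.simps) simp

lemma game_value_Blocker:
  "\<not> game_over n F C B \<Longrightarrow> game_value n H F Blocker C B =
     Min ((\<lambda>e. game_value n H F Constructor C (insert e B)) ` unclaimed n C B)"
  by (subst game_value.simps) simp

lemma finite_constructor_moves: "finite (constructor_moves n F C B)"
  using constructor_moves_unclaimed finite_unclaimed finite_subset by metis

lemma game_value_Constructor_ge:
  assumes "e \<in> constructor_moves n F C B"
  shows "game_value n H F Blocker (insert e C) B \<le> game_value n H F Constructor C B"
proof -
  have "\<not> game_over n F C B"
    using assms by (auto simp: game_over_def constructor_moves_def)
  then show ?thesis
    using assms finite_constructor_moves[of n F C B] by (simp add: game_value_Constructor)
qed

lemma game_value_Blocker_geI:
  assumes "game_over n F C B \<Longrightarrow> t \<le> card (copies H ({..<n}, C))"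
    and "\<And>e. \<not> game_over n F C B \<Longrightarrow> e \<in> unclaimed n C B \<Longrightarrow>
           t \<le> game_value n H F Constructor C (insert e B)"
  shows "t \<le> game_value n H F Blocker C B"
proof (cases "game_over n F C B")
  case True
  then show ?thesis using assms(1) by (simp add: game_value_over)
next
  case False
  then have "unclaimed n C B \<noteq> {}" by (auto simp: game_over_def)
  then show ?thesis using False assms(2) finite_unclaimed[of n C B]
    by (simp add: game_value_Blocker)
qed

text \<open>Copies that Constructor has built are never lost, so a strategy need only be specified up to
  the moment when enough of them are complete; the moves that she is forced to make later do no harm.\<close>
lemma card_copies_le_game_value:
  assumes "finite C"
  shows "card (copies H ({..<n}, C)) \<le> game_value n H F p C B"
  using assms
proof (induction n H F p C B rule: game_value.induct)
  case (1 n H F C B)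
  show ?case
  proof (cases "game_over n F C B")
    case True
    then show ?thesis by (simp add: game_value_over)
  next
    case False
    then obtain e where e: "e \<in> constructor_moves n F C B"
      by (auto simp: game_over_def)
    have "card (copies H ({..<n}, C)) \<le> card (copies H ({..<n}, insert e C))"
      using 1(2) by (intro card_copies_mono) auto
    also have "\<dots> \<le> game_value n H F Blocker (insert e C) B"
      using 1(1)[OF False e] 1(2) by simp
    also have "\<dots> \<le> game_value n H F Constructor C B"
      by (rule game_value_Constructor_ge[OF e])
    finally show ?thesis .
  qed
next
  case (2 n H F C B)
  show ?case
    by (rule game_value_Blocker_geI) (simp, rule 2(1), simp_all add: 2(2))
qed

lemma game_value_le:
  assumes bound: "\<And>C. C \<subseteq> edges (complete_graph n) \<Longrightarrow> free_of F ({..<n}, C)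
             \<Longrightarrow> card (copies H ({..<n}, C)) \<le> t"
    and "C \<subseteq> edges (complete_graph n)" "free_of F ({..<n}, C)"
  shows "game_value n H F p C B \<le> t"
  using assms
proof (induction n H F p C B rule: game_value.induct)
  case (1 n H F C B)
  show ?case
  proof (cases "game_over n F C B")
    case True
    then show ?thesis using 1(2)[OF 1(3,4)] by (simp add: game_value_over)
  next
    case False
    have "game_value n H F Blocker (insert e C) B \<le> t"
      if e: "e \<in> constructor_moves n F C B" for e
    proof (rule 1(1)[OF False e 1(2)])
      show "insert e C \<subseteq> edges (complete_graph n)" "free_of F ({..<n}, insert e C)"
        using e 1(3) by (auto simp: constructor_moves_def unclaimed_def)
    qed
    moreover have "constructor_moves n F C B \<noteq> {}"
      using False by (auto simp: game_over_def)
    ultimately show ?thesis using False finite_constructor_moves[of n F C B]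
      by (simp add: game_value_Constructor)
  qed
next
  case (2 n H F C B)
  show ?case
  proof (cases "game_over n F C B")
    case True
    then show ?thesis using 2(2)[OF 2(3,4)] by (simp add: game_value_over)
  next
    case False
    then obtain e where e: "e \<in> unclaimed n C B"
      by (auto simp: game_over_def)
    have "game_value n H F Constructor C (insert e B) \<le> t"
      by (rule 2(1)[OF False e 2(2) 2(3,4)])
    moreover have "game_value n H F Blocker C B \<le> game_value n H F Constructor C (insert e B)"
      using False e finite_unclaimed[of n C B] by (auto simp: game_value_Blocker intro: Min_le)
    ultimately show ?thesis by simp
  qed
qed

text \<open>The induction needs a position in which Blocker may already have taken one edge of a single
  pair \<open>j0\<close>. Constructor takes the other edge of that pair, or any edge of any pair if none is touched;
  Blocker's reply spoils at most one edge of one remaining pair, so the invariant is restored.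
  The index \<open>j0\<close> need not belong to \<open>J\<close>, which covers the case that no pair is touched.\<close>
lemma pairing_aux:
  fixes g :: "'i \<times> bool \<Rightarrow> nat set"
  assumes "finite J"
    and "inj_on g (J \<times> UNIV)"
    and "g ` (J \<times> UNIV) \<subseteq> edges (complete_graph n) - C"
    and "free_of F ({..<n}, C \<union> g ` (J \<times> UNIV))"
    and "finite B"
    and "\<And>j. j \<in> J - {j0} \<Longrightarrow> g (j, True) \<notin> B \<and> g (j, False) \<notin> B"
    and "g (j0, s0) \<notin> B"
    and "\<And>\<sigma> B'. finite B' \<Longrightarrow> B \<subseteq> B' \<Longrightarrow> card B' \<le> card B + card J
          \<Longrightarrow> t \<le> game_value n H F Constructor (C \<union> (\<lambda>j. g (j, \<sigma> j)) ` J) B'"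
  shows "t \<le> game_value n H F Constructor C B"
  using assms
proof (induction "card J" arbitrary: J C B j0 s0)
  case 0
  then have "J = {}" by simp
  then show ?case using 0(9)[of B] 0 by auto
next
  case (Suc m)
  obtain j s where j: "j \<in> J" and js: "g (j, s) \<notin> B"
    and others: "\<And>i. i \<in> J - {j} \<Longrightarrow> g (i, True) \<notin> B \<and> g (i, False) \<notin> B"
  proof (cases "j0 \<in> J")
    case True
    then show ?thesis using that[of j0 s0] Suc.prems(6,7) by blast
  next
    case False
    obtain j where "j \<in> J" using Suc.hyps(2) by fastforce
    then show ?thesis using that[of j True] Suc.prems(6) False by blast
  qed
  define e where "e = g (j, s)"
  define J' where "J' = J - {j}"
  have J: "J = insert j J'" "j \<notin> J'" "finite J'" using j Suc.prems(1) by (auto simp: J'_def)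
  have cJ: "card J = Suc (card J')" using J by simp
  have inj': "inj_on g (J' \<times> UNIV)"
    by (rule inj_on_subset[OF Suc.prems(2)]) (auto simp: J)
  have e_notin: "e \<notin> g ` (J' \<times> UNIV)"
    using Suc.prems(2) J unfolding e_def by (auto simp: inj_on_def)
  have fr: "free_of F ({..<n}, insert e C \<union> g ` (J' \<times> UNIV))"
    by (rule free_of_mono[OF Suc.prems(4)]) (auto simp: J e_def)
  have move: "x \<in> constructor_moves n F D B"
    if "x \<in> g ` (J \<times> UNIV)" "x \<notin> B" "x \<notin> D" "D \<subseteq> C \<union> g ` (J \<times> UNIV)" for x D
  proof -
    have "free_of F ({..<n}, insert x D)"
      by (rule free_of_mono[OF Suc.prems(4)]) (use that in auto)
    then show ?thesis using that Suc.prems(3)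
      by (auto simp: constructor_moves_def unclaimed_def)
  qed
  have cont: "t \<le> game_value n H F Constructor (insert e C \<union> (\<lambda>i. g (i, \<sigma> i)) ` J') B'"
    if "finite B'" "B \<subseteq> B'" "card B' \<le> card B + card J" for \<sigma> B'
  proof -
    have "(\<lambda>i. g (i, (\<sigma>(j := s)) i)) ` J' = (\<lambda>i. g (i, \<sigma> i)) ` J'"
      using J(2) by (intro image_cong) auto
    then have "C \<union> (\<lambda>i. g (i, (\<sigma>(j := s)) i)) ` J = insert e C \<union> (\<lambda>i. g (i, \<sigma> i)) ` J'"
      by (simp add: J(1) e_def)
    then show ?thesis using Suc.prems(8)[of B' "\<sigma>(j := s)"] that by simp
  qed
  have "t \<le> game_value n H F Blocker (insert e C) B"
  proof (rule game_value_Blocker_geI)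
    assume over: "game_over n F (insert e C) B"
    have "J' = {}"
    proof (rule ccontr)
      assume "J' \<noteq> {}"
      then obtain i where i: "i \<in> J'" by blast
      have "g (i, True) \<in> constructor_moves n F (insert e C) B"
      proof (rule move)
        show "g (i, True) \<notin> insert e C"
          using i e_notin subsetD[OF Suc.prems(3), of "g (i, True)"] J(1) by blast
        show "g (i, True) \<notin> B" using i others J by blast
      qed (use i J e_def in auto)
      then show False using over by (auto simp: game_over_def constructor_moves_def)
    qed
    then have "t \<le> game_value n H F Constructor (insert e C) B"
      using cont[of B] Suc.prems(5) by simp
    then show "t \<le> card (copies H ({..<n}, insert e C))"
      using over by (simp add: game_value_over)
  next
    fix f assume f: "f \<in> unclaimed n (insert e C) B"
    show "t \<le> game_value n H F Constructor (insert e C) (insert f B)"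
    proof -
      obtain i0 r where i0: "\<And>i. i \<in> J' - {i0} \<Longrightarrow> g (i, True) \<noteq> f \<and> g (i, False) \<noteq> f"
        and r: "g (i0, r) \<noteq> f" "g (i0, r) \<notin> B"
      proof (cases "\<exists>i b. i \<in> J' \<and> g (i, b) = f")
        case True
        then obtain i b where ib: "i \<in> J'" "g (i, b) = f" by blast
        have u: "i' = i \<and> b' = b" if "i' \<in> J'" "g (i', b') = f" for i' b'
        proof -
          have "(i', b') = (i, b)"
            by (rule inj_onD[OF inj']) (use that ib in auto)
          then show ?thesis by simp
        qed
        show ?thesis
        proof (rule that[of i "\<not> b"])
          show "g (i, \<not> b) \<noteq> f" using u[OF ib(1), of "\<not> b"] by auto
          show "g (i, \<not> b) \<notin> B" using others[of i] ib J by (cases b) auto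
        qed (use u in blast)
      next
        case False
        show ?thesis
          by (rule that[of j s]) (use False js f in \<open>auto simp: e_def unclaimed_def\<close>)
      qed
      show ?thesis
      proof (rule Suc.hyps(1)[of J' "insert e C" "insert f B" i0 r])
        show "m = card J'" using Suc.hyps(2) cJ by simp
        show "g ` (J' \<times> UNIV) \<subseteq> edges (complete_graph n) - insert e C"
          using Suc.prems(3) e_notin J by auto
        show "finite (insert f B)" using Suc.prems(5) by simp
        show "g (i, True) \<notin> insert f B \<and> g (i, False) \<notin> insert f B"
          if "i \<in> J' - {i0}" for i
          using that i0[OF that] others[of i] J by auto
        show "g (i0, r) \<notin> insert f B" using r by simp
        fix \<sigma> B' assume B': "finite B'" "insert f B \<subseteq> B'" "card B' \<le> card (insert f B) + card J'"
        have "card (insert f B) \<le> Suc (card B)" by (rule card_insert_le_m1) auto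
        then have "card B' \<le> card B + card J" using B'(3) cJ by simp
        then show "t \<le> game_value n H F Constructor (insert e C \<union> (\<lambda>i. g (i, \<sigma> i)) ` J') B'"
          using cont B' by auto
      qed (use inj' fr J in auto)
    qed
  qed
  also have "\<dots> \<le> game_value n H F Constructor C B"
  proof (rule game_value_Constructor_ge, rule move)
    show "e \<notin> C" using Suc.prems(3) j by (auto simp: e_def)
  qed (use j js e_def in auto)
  finally show ?case .
qed

text \<open>The conclusion is phrased as a reduction: to guarantee a value \<open>t\<close> it suffices to guarantee it
  from every position in which Constructor owns one edge of each pair and Blocker has made at most
  one move per pair.\<close>
lemma pairing:
  fixes g :: "'i \<times> bool \<Rightarrow> nat set"
  assumes "finite J" "inj_on g (J \<times> UNIV)"
    and "g ` (J \<times> UNIV) \<subseteq> edges (complete_graph n) - (C \<union> B)"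
    and "free_of F ({..<n}, C \<union> g ` (J \<times> UNIV))"
    and "finite B"
    and "\<And>\<sigma> B'. finite B' \<Longrightarrow> B \<subseteq> B' \<Longrightarrow> card B' \<le> card B + card J
          \<Longrightarrow> t \<le> game_value n H F Constructor (C \<union> (\<lambda>j. g (j, \<sigma> j)) ` J) B'"
  shows "t \<le> game_value n H F Constructor C B"
proof (cases "J = {}")
  case True
  then show ?thesis using assms(6)[of B] assms(5) by simp
next
  case False
  then obtain j0 where "j0 \<in> J" by blast
  then show ?thesis
    using assms by (intro pairing_aux[of J g n C F B j0 True t H]) auto
qed

text \<open>Pairing the edges of \<open>S\<close> arbitrarily gives half of them to Constructor.\<close>
lemma claim_half:
  assumes S: "finite S" "S \<subseteq> edges (complete_graph n) - (C \<union> B)"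
    and free: "free_of F ({..<n}, C \<union> S)"
    and B: "finite B"
    and cont: "\<And>S' B'. S' \<subseteq> S \<Longrightarrow> card S' = card S div 2 \<Longrightarrow> finite B' \<Longrightarrow> B \<subseteq> B'
          \<Longrightarrow> card B' \<le> card B + card S div 2
          \<Longrightarrow> t \<le> game_value n H F Constructor (C \<union> S') B'"
  shows "t \<le> game_value n H F Constructor C B"
proof -
  obtain u where u: "bij_betw u {0..<card S} S"
    using ex_bij_betw_nat_finite[OF S(1)] by blast
  define h where "h = card S div 2"
  define g where "g = (\<lambda>(j, b). u (2 * j + (if b then 1 else 0)))"
  have pos: "2 * j + (if b then 1 else 0) < card S" if "j < h" for j :: nat and b
    using that by (auto simp: h_def)
  have inj: "inj_on g ({..<h} \<times> UNIV)"
  proof (rule inj_onI)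
    fix x y assume x: "x \<in> {..<h} \<times> UNIV" and y: "y \<in> {..<h} \<times> UNIV" and eq: "g x = g y"
    obtain i b j c where [simp]: "x = (i, b)" "y = (j, c)" by fastforce
    have "2 * i + (if b then 1 else 0) = 2 * j + (if c then 1 else 0)"
      using bij_betw_imp_inj_on[OF u] eq pos[of i b] pos[of j c] x y
      by (auto simp: g_def inj_on_def simp del: if_split split del: if_split)
    then show "x = y" by (auto split: if_splits; presburger)
  qed
  have sub: "g ` ({..<h} \<times> UNIV) \<subseteq> S"
    using pos bij_betwE[OF u] by (auto simp: g_def)
  show ?thesis
  proof (rule pairing[OF _ inj])
    show "free_of F ({..<n}, C \<union> g ` ({..<h} \<times> UNIV))"
      by (rule free_of_mono[OF free]) (use sub in auto)
    fix \<sigma> B' assume B': "finite B'" "B \<subseteq> B'" "card B' \<le> card B + card {..<h}"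
    have "inj_on (\<lambda>j. g (j, \<sigma> j)) {..<h}"
      using inj by (auto simp: inj_on_def)
    then have "card ((\<lambda>j. g (j, \<sigma> j)) ` {..<h}) = card S div 2"
      by (simp add: card_image h_def)
    then show "t \<le> game_value n H F Constructor (C \<union> (\<lambda>j. g (j, \<sigma> j)) ` {..<h}) B'"
      using B' sub by (intro cont) (auto simp: h_def)
  qed (use sub S B in auto)
qed

section \<open>Cycles and triangles as subgraphs\<close>

text \<open>A copy of a cycle is the same as a cyclic sequence of distinct vertices with consecutive ones
  adjacent; all arguments about forbidden cycles use the latter form.\<close>
lemma free_of_cycle_graph_iff:
  assumes "3 \<le> l"
  shows "free_of (cycle_graph l) (V, E) \<longleftrightarrow>
    \<not> (\<exists>v. inj_on v {..<l} \<and> v ` {..<l} \<subseteq> V \<and> (\<forall>i<l. {v i, v (Suc i mod l)} \<in> E))"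
    (is "_ \<longleftrightarrow> \<not> ?cyc")
proof -
  have lt: "Suc i mod l < l" for i using assms by simp
  have neq: "Suc i mod l \<noteq> i" if "i < l" for i
  proof (cases "Suc i = l")
    case True
    then show ?thesis using assms by simp
  next
    case False
    then show ?thesis using that by (simp add: Suc_lessI)
  qed
  have "copies (cycle_graph l) (V, E) \<noteq> {}" if ?cyc
  proof -
    from that obtain v where inj: "inj_on v {..<l}" and sub: "v ` {..<l} \<subseteq> V"
      and edge: "\<And>i. i < l \<Longrightarrow> {v i, v (Suc i mod l)} \<in> E" by blast
    define S where "S = (v ` {..<l}, {{v i, v (Suc i mod l)} | i. i < l})"
    have "card {v i, v (Suc i mod l)} = 2" if "i < l" for i
    proof -
      have "v i \<noteq> v (Suc i mod l)"
        using neq[OF that] that lt[of i] inj_onD[OF inj, of i "Suc i mod l"] by auto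
      then show ?thesis by simp
    qed
    then have "subgraph S (V, E)"
      using sub edge lt by (auto simp: S_def subgraph_def simple_graph_def)
    moreover have "isomorphic S (cycle_graph l)"
      unfolding isomorphic_def
    proof (intro exI conjI)
      let ?f = "the_inv_into {..<l} v"
      show "bij_betw ?f (verts S) (verts (cycle_graph l))"
        using bij_betw_the_inv_into[of v "{..<l}" "v ` {..<l}"] inj
        by (simp add: S_def cycle_graph_def bij_betw_def)
      have f: "?f (v i) = i" if "i < l" for i
        using the_inv_into_f_f[OF inj] that by simp
      have "edges S = (\<lambda>i. {v i, v (Suc i mod l)}) ` {..<l}"
        by (auto simp: S_def)
      then have "(\<lambda>e. ?f ` e) ` edges S = (\<lambda>i. ?f ` {v i, v (Suc i mod l)}) ` {..<l}"
        by (simp only: image_image)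
      also have "\<dots> = (\<lambda>i. {i, Suc i mod l}) ` {..<l}"
        by (intro image_cong) (auto simp: f lt)
      also have "\<dots> = edges (cycle_graph l)"
        by (auto simp: cycle_graph_def)
      finally show "(\<lambda>e. ?f ` e) ` edges S = edges (cycle_graph l)" .
    qed
    ultimately have "S \<in> copies (cycle_graph l) (V, E)" by (simp add: copies_def)
    then show ?thesis by blast
  qed
  moreover have ?cyc if "copies (cycle_graph l) (V, E) \<noteq> {}"
  proof -
    from that obtain S where "S \<in> copies (cycle_graph l) (V, E)" by blast
    then have S: "subgraph S (V, E)" and "isomorphic S (cycle_graph l)"
      unfolding copies_def by blast+
    then obtain f where "bij_betw f (verts S) (verts (cycle_graph l))"
      and "(\<lambda>e. f ` e) ` edges S = edges (cycle_graph l)"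
      unfolding isomorphic_def by blast
    then have f: "bij_betw f (verts S) {..<l}"
      and e: "(\<lambda>e. f ` e) ` edges S = {{i, Suc i mod l} | i. i < l}"
      by (simp_all add: cycle_graph_def)
    define v where "v = the_inv_into (verts S) f"
    have v: "bij_betw v {..<l} (verts S)"
      unfolding v_def by (rule bij_betw_the_inv_into[OF f])
    have edge: "{v i, v (Suc i mod l)} \<in> E" if "i < l" for i
    proof -
      have "{i, Suc i mod l} \<in> (\<lambda>e. f ` e) ` edges S"
        unfolding e using that by blast
      then obtain d where d: "d \<in> edges S" "{i, Suc i mod l} = f ` d" by blast
      have dV: "d \<subseteq> verts S" and dE: "d \<in> E"
        using S d(1) by (auto simp: subgraph_def simple_graph_def)
      have "v ` f ` d = d"
        using dV the_inv_into_f_f[OF bij_betw_imp_inj_on[OF f]]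
        by (force simp: v_def image_image)
      then have "{v i, v (Suc i mod l)} = d" using d(2) by (metis image_insert image_empty)
      then show ?thesis using dE by simp
    qed
    show ?thesis
    proof (intro exI conjI)
      show "inj_on v {..<l}" "v ` {..<l} \<subseteq> V"
        using v S by (auto simp: bij_betw_def subgraph_def)
    qed (use edge in blast)
  qed
  ultimately show ?thesis unfolding free_of_def by blast
qed

definition triangles :: "'a set set \<Rightarrow> 'a set set" where
  "triangles E = {t. card t = 3 \<and> (\<forall>e. e \<subseteq> t \<and> card e = 2 \<longrightarrow> e \<in> E)}"

lemma insert_in_triangles_iff:
  assumes "x \<noteq> y" "y \<noteq> z" "x \<noteq> z"
  shows "{x, y, z} \<in> triangles E \<longleftrightarrow> {x, y} \<in> E \<and> {y, z} \<in> E \<and> {x, z} \<in> E"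
proof -
  have "e \<subseteq> {x, y, z} \<and> card e = 2 \<longleftrightarrow> e = {x, y} \<or> e = {y, z} \<or> e = {x, z}" for e
    using assms by (auto simp: card_2_iff doubleton_eq_iff)
  then show ?thesis using assms unfolding triangles_def by auto
qed

lemma triangle_subset_Union:
  assumes "t \<in> triangles E" shows "t \<subseteq> \<Union>E"
proof -
  from assms obtain x y z where "t = {x, y, z}" "x \<noteq> y" "y \<noteq> z" "x \<noteq> z"
    by (auto simp: triangles_def card_3_iff)
  then show ?thesis using assms insert_in_triangles_iff[of x y z E] by auto
qed

text \<open>A copy of \<open>K\<^sub>3\<close> is determined by its vertex set, which makes the vertex sets of triangles the
  convenient objects to count.\<close>
lemma card_copies_complete_3:
  assumes "E \<subseteq> {e. e \<subseteq> V \<and> card e = 2}"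
  shows "card (copies (complete_graph 3) (V, E)) = card (triangles E)"
proof -
  define G where "G = (\<lambda>t :: 'a set. (t, {e. e \<subseteq> t \<and> card e = 2}))"
  have "copies (complete_graph 3) (V, E) = G ` triangles E"
  proof (intro set_eqI iffI)
    fix S assume "S \<in> copies (complete_graph 3) (V, E)"
    then have S: "subgraph S (V, E)" and "isomorphic S (complete_graph 3)"
      unfolding copies_def by blast+
    then obtain f where "bij_betw f (verts S) (verts (complete_graph 3))"
      and "(\<lambda>e. f ` e) ` edges S = edges (complete_graph 3)"
      unfolding isomorphic_def by blast
    then have f: "bij_betw f (verts S) {..<3}"
      and e: "(\<lambda>e. f ` e) ` edges S = {e. e \<subseteq> {..<3} \<and> card e = 2}"
      by (simp_all add: complete_graph_def)
    have sg: "\<And>d. d \<in> edges S \<Longrightarrow> d \<subseteq> verts S \<and> card d = 2"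
      using S by (auto simp: subgraph_def simple_graph_def)
    have "d \<in> edges S" if d: "d \<subseteq> verts S" "card d = 2" for d
    proof -
      have inj: "inj_on f (verts S)" and im: "f ` verts S = {..<3}"
        using f by (auto simp: bij_betw_def)
      have "card (f ` d) = 2" using d inj by (simp add: card_image inj_on_subset)
      then have "f ` d \<in> (\<lambda>e. f ` e) ` edges S" unfolding e using d im by auto
      then obtain d' where d': "d' \<in> edges S" "f ` d = f ` d'" by blast
      have "d = d'" using inj_on_image_eq_iff[OF inj d(1), of d'] sg[OF d'(1)] d'(2) by simp
      then show ?thesis using d'(1) by simp
    qed
    then have "edges S = {e. e \<subseteq> verts S \<and> card e = 2}" using sg by blast
    then have "S = G (verts S)" by (simp add: G_def prod_eq_iff)
    moreover have "verts S \<in> triangles E"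
      using bij_betw_same_card[OF f] \<open>edges S = _\<close> S
      by (auto simp: triangles_def subgraph_def)
    ultimately show "S \<in> G ` triangles E" by blast
  next
    fix S assume "S \<in> G ` triangles E"
    then obtain t where t: "t \<in> triangles E" and S: "S = G t" by blast
    have c: "card t = 3" and ed: "\<And>e. e \<subseteq> t \<Longrightarrow> card e = 2 \<Longrightarrow> e \<in> E"
      using t by (auto simp: triangles_def)
    have fin: "finite t" using c by (metis card.infinite zero_neq_numeral)
    have "t \<subseteq> V" using triangle_subset_Union[OF t] assms by blast
    obtain f where f: "bij_betw f t {..<3::nat}"
      using ex_bij_betw_finite_nat[OF fin] c by (metis atLeast0LessThan)
    have inj: "inj_on f t" and im: "f ` t = {..<3}" using f by (auto simp: bij_betw_def)
    have "(\<lambda>e. f ` e) ` edges S = {e. e \<subseteq> {..<3} \<and> card e = 2}"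
    proof (intro set_eqI iffI)
      fix d assume "d \<in> (\<lambda>e. f ` e) ` edges S"
      then obtain e where "d = f ` e" "e \<subseteq> t" "card e = 2" by (auto simp: S G_def)
      then show "d \<in> {e. e \<subseteq> {..<3} \<and> card e = 2}"
        using im inj by (auto simp: card_image inj_on_subset)
    next
      fix d assume "d \<in> {e :: nat set. e \<subseteq> {..<3} \<and> card e = 2}"
      then have d: "d \<subseteq> f ` t" "card d = 2" using im by auto
      then obtain e where e: "e \<subseteq> t" "d = f ` e" by (meson subset_imageE)
      moreover have "card e = 2" using d e inj by (metis card_image inj_on_subset)
      ultimately show "d \<in> (\<lambda>e. f ` e) ` edges S" by (auto simp: S G_def)
    qed
    then have "isomorphic S (complete_graph 3)"
      unfolding isomorphic_def using f
      by (intro exI[of _ f]) (simp add: S G_def complete_graph_def)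
    moreover have "subgraph S (V, E)"
      using fin \<open>t \<subseteq> V\<close> ed by (auto simp: S G_def subgraph_def simple_graph_def)
    ultimately show "S \<in> copies (complete_graph 3) (V, E)" by (simp add: copies_def)
  qed
  moreover have "inj_on G (triangles E)" by (auto simp: G_def inj_on_def)
  ultimately show ?thesis by (simp add: card_image)
qed

lemma cycle_in_free_graphD:
  assumes "free_of (cycle_graph l) (V, E)" "3 \<le> l" "inj_on v {..<l}" "v ` {..<l} \<subseteq> V"
    and "\<And>i. i < l \<Longrightarrow> {v i, v (Suc i mod l)} \<in> E"
  shows False
  using assms free_of_cycle_graph_iff[OF assms(2), of V E] by blast

section \<open>Claiming triangles\<close>

text \<open>Constructor completes the triangles belonging to the half of \<open>S\<close> that she obtains; injectivity
  ensures that no triangle is counted twice.\<close>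
lemma claim_triangles:
  assumes C: "C \<subseteq> edges (complete_graph n)"
    and S: "S \<subseteq> edges (complete_graph n) - (C \<union> B)"
    and free: "free_of F ({..<n}, C \<union> S)"
    and B: "finite B"
    and inj: "inj_on (\<lambda>e. insert (apex e) e) S"
    and tri: "\<And>e. e \<in> S \<Longrightarrow> insert (apex e) e \<in> triangles (insert e C)"
  shows "card S div 2 \<le> game_value n (complete_graph 3) F Constructor C B"
proof (rule claim_half[OF _ S free B])
  have finE: "finite (edges (complete_graph n))" by (rule finite_edges_complete)
  show "finite S" using finite_subset[OF _ finE] S by blast
  fix S' B' assume S': "S' \<subseteq> S" "card S' = card S div 2"
  have sub: "C \<union> S' \<subseteq> edges (complete_graph n)" using C S S' by blast
  have fin: "finite (C \<union> S')" by (rule finite_subset[OF sub finE])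
  have "(\<lambda>e. insert (apex e) e) ` S' \<subseteq> triangles (C \<union> S')"
  proof (intro image_subsetI)
    fix e assume "e \<in> S'"
    then have "insert (apex e) e \<in> triangles (insert e C)" and "insert e C \<subseteq> C \<union> S'"
      using tri S' by auto
    then show "insert (apex e) e \<in> triangles (C \<union> S')"
      unfolding triangles_def by blast
  qed
  moreover have "finite (triangles (C \<union> S'))"
  proof (rule finite_subset)
    show "triangles (C \<union> S') \<subseteq> Pow (\<Union>(C \<union> S'))" using triangle_subset_Union by blast
    have "\<Union>(C \<union> S') \<subseteq> {..<n}" using sub by (auto simp: complete_graph_def)
    then show "finite (Pow (\<Union>(C \<union> S')))" using finite_subset by blast
  qed
  ultimately have "card ((\<lambda>e. insert (apex e) e) ` S') \<le> card (triangles (C \<union> S'))"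
    by (intro card_mono)
  then have "card S div 2 \<le> card (triangles (C \<union> S'))"
    using S' inj by (simp add: card_image inj_on_subset)
  also have "\<dots> = card (copies (complete_graph 3) ({..<n}, C \<union> S'))"
    using sub by (subst card_copies_complete_3) (auto simp: complete_graph_def)
  also have "\<dots> \<le> game_value n (complete_graph 3) F Constructor (C \<union> S') B'"
    by (rule card_copies_le_game_value[OF fin])
  finally show "card S div 2 \<le> game_value n (complete_graph 3) F Constructor (C \<union> S') B'" .
qed

lemma claim_indexed_triangles:
  assumes C: "C \<subseteq> edges (complete_graph n)"
    and S: "\<phi> ` T \<subseteq> edges (complete_graph n) - (C \<union> B)"
    and free: "free_of F ({..<n}, C \<union> \<phi> ` T)"
    and B: "finite B"
    and inj: "inj_on \<phi> T" "inj_on (\<lambda>x. insert (a x) (\<phi> x)) T"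
    and tri: "\<And>x. x \<in> T \<Longrightarrow> insert (a x) (\<phi> x) \<in> triangles (insert (\<phi> x) C)"
  shows "card T div 2 \<le> game_value n (complete_graph 3) F Constructor C B"
proof -
  define apex where "apex = (\<lambda>e. a (the_inv_into T \<phi> e))"
  have apex: "apex (\<phi> x) = a x" if "x \<in> T" for x
    using the_inv_into_f_f[OF inj(1) that] by (simp add: apex_def)
  have "card (\<phi> ` T) div 2 \<le> game_value n (complete_graph 3) F Constructor C B"
  proof (rule claim_triangles[OF C S free B, of apex])
    show "inj_on (\<lambda>e. insert (apex e) e) (\<phi> ` T)"
    proof (rule inj_onI)
      fix d e assume "d \<in> \<phi> ` T" "e \<in> \<phi> ` T" and eq: "insert (apex d) d = insert (apex e) e"
      then obtain x y where xy: "x \<in> T" "y \<in> T" "d = \<phi> x" "e = \<phi> y" by blast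
      then have "insert (a x) (\<phi> x) = insert (a y) (\<phi> y)" using eq apex by simp
      then show "d = e" using inj_onD[OF inj(2)] xy by blast
    qed
    show "insert (apex e) e \<in> triangles (insert e C)" if "e \<in> \<phi> ` T" for e
      using that tri apex by auto
  qed
  then show ?thesis using inj(1) by (simp add: card_image)
qed

section \<open>Few triangles in graphs without a given even cycle\<close>

text \<open>Remove vertices of degree at most \<open>m\<close> as long as there are any; each removal costs at most \<open>m\<close>
  edges. If this gets stuck, all degrees exceed \<open>m\<close> and a path can be extended greedily until it has
  \<open>m\<close> vertices.\<close>
lemma card_edges_le_of_no_path:
  assumes "finite W" "F \<subseteq> {e. e \<subseteq> W \<and> card e = 2}" "m \<ge> 1"
    and "\<not> (\<exists>ws. distinct ws \<and> length ws = m \<and> set ws \<subseteq> W \<and> successively (\<lambda>x y. {x, y} \<in> F) ws)"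
  shows "card F \<le> m * card W"
  using assms
proof (induction "card W" arbitrary: W F)
  case 0
  then have "F = {}" by auto
  then show ?case by simp
next
  case (Suc c)
  have finF: "finite F"
    by (rule finite_subset[OF Suc.prems(2)]) (simp add: Suc.prems(1))
  define N where "N = (\<lambda>x. {y \<in> W. {x, y} \<in> F})"
  have finN: "finite (N x)" for x using Suc.prems(1) by (simp add: N_def)
  show ?case
  proof (cases "\<exists>x\<in>W. card (N x) \<le> m")
    case True
    then obtain x where x: "x \<in> W" "card (N x) \<le> m" by blast
    define F' where "F' = {e \<in> F. x \<notin> e}"
    have "\<not> (\<exists>ws. distinct ws \<and> length ws = m \<and> set ws \<subseteq> W - {x} \<and> successively (\<lambda>x y. {x, y} \<in> F') ws)"
    proof
      assume "\<exists>ws. distinct ws \<and> length ws = m \<and> set ws \<subseteq> W - {x} \<and> successively (\<lambda>x y. {x, y} \<in> F') ws"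
      then obtain ws where ws: "distinct ws" "length ws = m" "set ws \<subseteq> W - {x}"
        "successively (\<lambda>x y. {x, y} \<in> F') ws" by blast
      have "successively (\<lambda>x y. {x, y} \<in> F) ws"
        by (rule successively_mono[OF ws(4)]) (auto simp: F'_def)
      then show False using Suc.prems(4) ws by blast
    qed
    then have IH: "card F' \<le> m * card (W - {x})"
      using Suc.prems x(1) Suc.hyps(2) by (intro Suc.hyps(1)) (auto simp: F'_def)
    have "F \<subseteq> F' \<union> (\<lambda>y. {x, y}) ` N x"
    proof
      fix e assume e: "e \<in> F"
      show "e \<in> F' \<union> (\<lambda>y. {x, y}) ` N x"
      proof (cases "x \<in> e")
        case True
        obtain a b where ab: "e = {a, b}" "a \<in> W" "b \<in> W"
          using e Suc.prems(2) by (auto simp: card_2_iff)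
        then show ?thesis using True e
          by (auto simp: N_def insert_commute)
      qed (use e F'_def in auto)
    qed
    then have "card F \<le> card (F' \<union> (\<lambda>y. {x, y}) ` N x)"
      using finF finN by (intro card_mono) (auto simp: F'_def)
    also have "\<dots> \<le> card F' + card (N x)"
      by (rule order.trans[OF card_Un_le]) (simp add: card_image_le finN)
    also have "\<dots> \<le> m * c + m"
    proof -
      have "card (W - {x}) = c" using Suc.hyps(2) x(1) Suc.prems(1) by simp
      then show ?thesis using IH x(2) by simp
    qed
    also have "\<dots> = m * card W" by (simp flip: Suc.hyps(2))
    finally show ?thesis .
  next
    case False
    have "\<exists>ws. distinct ws \<and> length ws = Suc l \<and> set ws \<subseteq> W \<and> successively (\<lambda>x y. {x, y} \<in> F) ws"
      if "Suc l \<le> m" for l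
      using that
    proof (induction l)
      case 0
      obtain x where "x \<in> W" using Suc.hyps(2) by fastforce
      then show ?case by (intro exI[of _ "[x]"]) simp
    next
      case (Suc l)
      then obtain ws where ws: "distinct ws" "length ws = Suc l" "set ws \<subseteq> W"
        "successively (\<lambda>x y. {x, y} \<in> F) ws" by auto
      then obtain x xs where xs: "ws = x # xs" by (cases ws) auto
      have "card (set ws) < card (N x)"
        using False ws xs Suc.prems distinct_card[OF ws(1)] by auto
      then obtain y where y: "y \<in> N x" "y \<notin> set ws"
        by (metis card_mono finite_set leD subsetI)
      have "{y, x} \<in> F" "y \<in> W" using y by (auto simp: N_def insert_commute)
      then show ?case using ws y xs by (intro exI[of _ "y # ws"]) auto
    qed
    from this[of "m - 1"] have False using Suc.prems(3,4) by auto
    then show ?thesis ..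
  qed
qed

lemma card_oriented_edges:
  assumes "finite E" "\<And>e. e \<in> E \<Longrightarrow> card e = 2"
  shows "card {(x, y). {x, y} \<in> E} = 2 * card E"
proof -
  have two: "finite {(x, y). {x, y} = e} \<and> card {(x, y). {x, y} = e} = 2" if e: "e \<in> E" for e
  proof -
    obtain a b where "e = {a, b}" "a \<noteq> b" using assms(2)[OF e] by (auto simp: card_2_iff)
    then have "{(x, y). {x, y} = e} = {(a, b), (b, a)}" by (auto simp: doubleton_eq_iff)
    then show ?thesis using \<open>a \<noteq> b\<close> by simp
  qed
  have "{(x, y). {x, y} \<in> E} = (\<Union>e\<in>E. {(x, y). {x, y} = e})" by auto
  also have "card \<dots> = (\<Sum>e\<in>E. card {(x, y). {x, y} = e})"
    using assms(1) two by (intro card_UN_disjoint) auto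
  also have "\<dots> = 2 * card E" using two by simp
  finally show ?thesis .
qed

lemma sum_degrees:
  assumes "E \<subseteq> edges (complete_graph n)"
  shows "(\<Sum>v<n. card {y. {v, y} \<in> E}) = 2 * card E"
proof -
  have E: "finite E" "\<And>e. e \<in> E \<Longrightarrow> card e = 2" "\<And>e. e \<in> E \<Longrightarrow> e \<subseteq> {..<n}"
    using assms finite_subset[OF assms finite_edges_complete] by (auto simp: complete_graph_def)
  have "finite {y. {v, y} \<in> E}" for v
    by (rule finite_subset[of _ "{..<n}"]) (use E(3) in auto)
  then have "(\<Sum>v<n. card {y. {v, y} \<in> E}) = card (SIGMA v:{..<n}. {y. {v, y} \<in> E})"
    by simp
  also have "(SIGMA v:{..<n}. {y. {v, y} \<in> E}) = {(x, y). {x, y} \<in> E}"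
    using E(3) by auto
  finally show ?thesis using card_oriented_edges[of E] E by simp
qed

text \<open>A path on \<open>2k - 1\<close> vertices in the neighbourhood of \<open>v\<close> together with \<open>v\<close> is a \<open>C\<^sub>2\<^sub>k\<close>. Hence \<open>v\<close>
  lies in at most \<open>2k deg v\<close> triangles, and the degrees sum to twice the number of edges.\<close>
lemma card_triangles_le:
  assumes "k \<ge> 2" "E \<subseteq> edges (complete_graph n)"
    and free: "free_of (cycle_graph (2 * k)) ({..<n}, E)"
  shows "card (triangles E) \<le> 4 * k * card E"
proof -
  have E: "finite E" "\<And>e. e \<in> E \<Longrightarrow> card e = 2" "\<And>e. e \<in> E \<Longrightarrow> e \<subseteq> {..<n}"
    using assms finite_subset[OF assms(2) finite_edges_complete] by (auto simp: complete_graph_def)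
  define N where "N = (\<lambda>v. {y. {v, y} \<in> E})"
  define F where "F = (\<lambda>v. {e \<in> E. e \<subseteq> N v})"
  have finN: "finite (N v)" for v
    by (rule finite_subset[of _ "{..<n}"]) (use E(3) in \<open>auto simp: N_def\<close>)
  have finF: "finite (F v)" for v using E(1) by (simp add: F_def)
  have local_bound: "card (F v) \<le> 2 * k * card (N v)" if v: "v < n" for v
  proof -
    have "\<not> (\<exists>ws. distinct ws \<and> length ws = 2 * k - 1 \<and> set ws \<subseteq> N v \<and> successively (\<lambda>x y. {x, y} \<in> F v) ws)"
    proof
      assume "\<exists>ws. distinct ws \<and> length ws = 2 * k - 1 \<and> set ws \<subseteq> N v \<and> successively (\<lambda>x y. {x, y} \<in> F v) ws"
      then obtain ws where ws: "distinct ws" "length ws = 2 * k - 1" "set ws \<subseteq> N v"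
        "successively (\<lambda>x y. {x, y} \<in> F v) ws" by blast
      have vN: "v \<notin> N v" using E(2)[of "{v}"] by (auto simp: N_def)
      define c where "c = v # ws"
      have len: "length c = 2 * k" using ws assms(1) by (simp add: c_def)
      have dist: "distinct c" using ws vN by (auto simp: c_def)
      have "{c ! i, c ! (Suc i mod (2 * k))} \<in> E" if i: "i < 2 * k" for i
      proof -
        have nth: "ws ! j \<in> N v" if "j < 2 * k - 1" for j using ws(2,3) that nth_mem[of j ws] by auto
        show ?thesis
        proof (cases "Suc i = 2 * k")
          case True
          then have "c ! i \<in> N v" using nth[of "i - 1"] assms(1) by (auto simp: c_def nth_Cons')
          then show ?thesis using True by (simp add: c_def N_def insert_commute)
        next
          case False
          then have si: "Suc i mod (2 * k) = Suc i" using i by simp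
          show ?thesis
          proof (cases i)
            case 0
            then show ?thesis using si nth[of 0] assms(1) by (simp add: c_def N_def)
          next
            case (Suc j)
            then have "{ws ! j, ws ! Suc j} \<in> F v"
              using ws(2,4) False i unfolding successively_conv_nth by simp
            then show ?thesis using si Suc by (simp add: c_def F_def)
          qed
        qed
      qed
      moreover have "inj_on (\<lambda>i. c ! i) {..<2 * k}"
        using dist len by (auto simp: inj_on_def nth_eq_iff_index_eq)
      moreover have "(\<lambda>i. c ! i) ` {..<2 * k} \<subseteq> {..<n}"
      proof -
        have "set c \<subseteq> {..<n}" using v ws(3) E(3) by (fastforce simp: c_def N_def)
        then show ?thesis using len by (auto simp: set_conv_nth)
      qed
      ultimately show False
        using assms(1) by (intro cycle_in_free_graphD[OF free, of "\<lambda>i. c ! i"]) auto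
    qed
    then have "card (F v) \<le> (2 * k - 1) * card (N v)"
      using assms(1) finN E(2) by (intro card_edges_le_of_no_path) (auto simp: F_def)
    also have "\<dots> \<le> 2 * k * card (N v)" by simp
    finally show ?thesis .
  qed
  have "triangles E \<subseteq> (\<Union>v<n. insert v ` F v)"
  proof
    fix t assume t: "t \<in> triangles E"
    then obtain x y z where xyz: "t = {x, y, z}" "x \<noteq> y" "y \<noteq> z" "x \<noteq> z"
      by (auto simp: triangles_def card_3_iff)
    then have e: "{x, y} \<in> E" "{y, z} \<in> E" "{x, z} \<in> E"
      using t insert_in_triangles_iff[of x y z E] by auto
    then have "x < n" "{y, z} \<in> F x" using E(3)[of "{x, y}"] by (auto simp: F_def N_def)
    then show "t \<in> (\<Union>v<n. insert v ` F v)" using xyz(1) by blast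
  qed
  then have "card (triangles E) \<le> card (\<Union>v<n. insert v ` F v)"
    using finF by (intro card_mono) auto
  also have "\<dots> \<le> (\<Sum>v<n. card (insert v ` F v))" by (rule card_UN_le) simp
  also have "\<dots> \<le> (\<Sum>v<n. 2 * k * card (N v))"
    by (rule sum_mono) (meson order.trans card_image_le finF local_bound lessThan_iff)
  also have "\<dots> = 4 * k * card E"
    using sum_degrees[OF assms(2)] by (simp add: N_def flip: sum_distrib_left)
  finally show ?thesis .
qed

lemma finite_ex_set:
  "finite {card E | E. E \<subseteq> edges (complete_graph n) \<and> P E}"
proof -
  have "{card E | E. E \<subseteq> edges (complete_graph n) \<and> P E} \<subseteq> card ` Pow (edges (complete_graph n))"
    by auto
  then show ?thesis by (rule finite_subset) (simp add: finite_edges_complete)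
qed

lemma card_le_ex_num:
  assumes "E \<subseteq> edges (complete_graph n)" "\<And>F. F \<in> \<F> \<Longrightarrow> free_of F ({..<n}, E)"
  shows "card E \<le> ex_num n \<F>"
  unfolding ex_num_def using assms by (intro Max_ge finite_ex_set) auto

lemma free_of_cycle_empty: "3 \<le> l \<Longrightarrow> free_of (cycle_graph l) (V, {})"
  by (subst free_of_cycle_graph_iff) (auto intro!: exI[of _ 0])

lemma ex_num_attained:
  assumes "\<And>F. F \<in> \<F> \<Longrightarrow> free_of F ({..<n}, {})"
  obtains E where "E \<subseteq> edges (complete_graph n)" "\<And>F. F \<in> \<F> \<Longrightarrow> free_of F ({..<n}, E)"
    "card E = ex_num n \<F>"
proof -
  have "ex_num n \<F> \<in> {card E | E. E \<subseteq> edges (complete_graph n) \<and> (\<forall>F\<in>\<F>. free_of F ({..<n}, E))}"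
    unfolding ex_num_def using assms by (intro Max_in finite_ex_set) (auto intro!: exI[of _ "{}"])
  then show ?thesis using that by auto
qed

lemma g_num_triangle_le:
  assumes "k \<ge> 2"
  shows "g_num n (complete_graph 3) (cycle_graph (2 * k)) \<le> 4 * k * ex_num n {cycle_graph (2 * k)}"
  unfolding g_num_def
proof (rule game_value_le)
  fix C assume C: "C \<subseteq> edges (complete_graph n)" "free_of (cycle_graph (2 * k)) ({..<n}, C)"
  have "card (copies (complete_graph 3) ({..<n}, C)) = card (triangles C)"
    using C by (intro card_copies_complete_3) (auto simp: complete_graph_def)
  also have "\<dots> \<le> 4 * k * card C" by (rule card_triangles_le[OF assms C])
  also have "\<dots> \<le> 4 * k * ex_num n {cycle_graph (2 * k)}"
    using C by (intro mult_left_mono card_le_ex_num) auto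
  finally show "card (copies (complete_graph 3) ({..<n}, C)) \<le> 4 * k * ex_num n {cycle_graph (2 * k)}" .
qed (use assms free_of_cycle_empty[of "2 * k"] in auto)

section \<open>Alternating cycles in bipartite graphs\<close>

text \<open>A walk from \<open>b\<close> in a bipartite graph, given by the successive pairs consisting of a vertex of the
  first part and the following vertex of the second part. Consecutive second components may agree.\<close>
fun alt_walk :: "('a \<times> 'b) set \<Rightarrow> 'b \<Rightarrow> ('a \<times> 'b) list \<Rightarrow> bool" where
  "alt_walk G b [] \<longleftrightarrow> True"
| "alt_walk G b ((a, b') # xs) \<longleftrightarrow> (a, b) \<in> G \<and> (a, b') \<in> G \<and> alt_walk G b' xs"

definition alt_cycle :: "('a \<times> 'b) set \<Rightarrow> ('a \<times> 'b) list \<Rightarrow> bool" where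
  "alt_cycle G xs \<longleftrightarrow> xs \<noteq> [] \<and> alt_walk G (snd (last xs)) xs"

text \<open>A simple alternating cycle of \<open>m\<close> pairs is a cycle of length \<open>2m\<close>, so this excludes exactly the
  cycles of length at most \<open>2k\<close>.\<close>
definition no_short_cycle :: "nat \<Rightarrow> ('a \<times> 'b) set \<Rightarrow> bool" where
  "no_short_cycle k G \<longleftrightarrow> (\<forall>xs. alt_cycle G xs \<and> distinct (map fst xs) \<and> distinct (map snd xs)
     \<and> 2 \<le> length xs \<longrightarrow> k < length xs)"

lemma alt_walk_append:
  "alt_walk G b (xs @ ys) \<longleftrightarrow> alt_walk G b xs \<and> alt_walk G (last (b # map snd xs)) ys"
  by (induction xs arbitrary: b) auto

text \<open>If the closed walk visits some \<open>b\<close> twice, it splits there into two shorter closed walks. The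
  vertices of the second part are not all equal to \<open>b\<close>, so one of the two pieces is again not
  constant on that part, and induction applies to it. Distinctness of the first components is
  inherited and rules out that the cycle found degenerates to a single edge.\<close>
lemma simple_alt_cycle_exists:
  assumes "alt_cycle G xs" "distinct (map fst xs)" "x \<in> set xs" "y \<in> set xs" "snd x \<noteq> snd y"
  shows "\<exists>ys. alt_cycle G ys \<and> distinct (map fst ys) \<and> distinct (map snd ys)
           \<and> 2 \<le> length ys \<and> length ys \<le> length xs"
  using assms
proof (induction "length xs" arbitrary: xs x y rule: less_induct)
  case less
  show ?case
  proof (cases "distinct (map snd xs)")
    case True
    have "length xs \<noteq> 0" "length xs \<noteq> 1"
      using less.prems(3-5) by (auto simp: length_Suc_conv)
    then have "2 \<le> length xs" by linarith
    then show ?thesis using True less.prems by blast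
  next
    case False
    then obtain us' vs' ws' b where "map snd xs = us' @ [b] @ vs' @ [b] @ ws'"
      using not_distinct_decomp by blast
    then obtain us vs ws p q where "xs = us @ [p] @ vs @ [q] @ ws" "snd p = b" "snd q = b"
      by (auto simp: map_eq_append_conv append_eq_map_conv map_eq_Cons_conv Cons_eq_map_conv)
    then obtain a a' where xs: "xs = us @ [(a, b)] @ vs @ [(a', b)] @ ws"
      by (metis prod.collapse)
    define ys where "ys = us @ (a, b) # ws"
    define zs where "zs = vs @ [(a', b)]"
    have "alt_cycle G zs"
      using less.prems(1) by (auto simp: alt_cycle_def xs zs_def alt_walk_append)
    moreover have "alt_cycle G ys"
      using less.prems(1) by (cases ws) (auto simp: alt_cycle_def xs ys_def alt_walk_append)
    moreover have "distinct (map fst zs)" "distinct (map fst ys)"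
      using less.prems(2) by (auto simp: xs zs_def ys_def)
    moreover have "length zs < length xs" "length ys < length xs"
      by (auto simp: xs zs_def ys_def)
    moreover obtain w where "w \<in> set xs" "snd w \<noteq> b" using less.prems(3-5) by metis
    then have "w \<in> set zs \<or> w \<in> set ys" by (auto simp: xs zs_def ys_def)
    moreover have "(a', b) \<in> set zs" "(a, b) \<in> set ys" by (auto simp: zs_def ys_def)
    ultimately have "\<exists>us. alt_cycle G us \<and> distinct (map fst us) \<and> length us < length xs \<and>
        w \<in> set us \<and> (\<exists>c. (c, b) \<in> set us)" by blast
    then obtain us c where us: "alt_cycle G us" "distinct (map fst us)" "length us < length xs"
        "w \<in> set us" "(c, b) \<in> set us" by blast
    then show ?thesis
      using less.hyps[OF us(3,1,2,4,5)] \<open>snd w \<noteq> b\<close> by fastforce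
  qed
qed

text \<open>Each vertex of \<open>A\<close> in a walk is recorded together with the fibre of its successor. This is the
  projection of a walk in a blow-up to the graph that was blown up.\<close>
fun project :: "'a set \<Rightarrow> ('a \<Rightarrow> 'b) \<Rightarrow> 'a list \<Rightarrow> ('a \<times> 'b) list" where
  "project A fib (x # y # zs) = (if x \<in> A then [(x, fib y)] else []) @ project A fib (y # zs)"
| "project A fib zs = []"

lemma map_fst_project: "map fst (project A fib ws) = filter (\<lambda>x. x \<in> A) (butlast ws)"
  by (induction A fib ws rule: project.induct) auto

text \<open>The inductive form of: a walk that never makes two consecutive visits to \<open>A\<close> spends at most half
  of its time there.\<close>
lemma length_filter_no_consecutive:
  assumes "successively (\<lambda>x y. x \<in> A \<longrightarrow> y \<notin> A) ws" "ws \<noteq> []" "last ws \<notin> A"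
  shows "2 * length (filter (\<lambda>x. x \<in> A) ws) + (if hd ws \<in> A then 0 else 1) \<le> length ws"
  using assms
proof (induction ws)
  case (Cons x xs)
  then show ?case by (cases xs) (auto split: if_splits)
qed simp

lemma project_alt_walk:
  assumes "successively R ws" "ws \<noteq> []" "hd ws \<notin> A" "last ws \<notin> A"
    and "\<And>x y. R x y \<Longrightarrow> x \<in> A \<Longrightarrow> y \<notin> A \<and> (x, fib y) \<in> G"
    and "\<And>x y. R x y \<Longrightarrow> y \<in> A \<Longrightarrow> x \<notin> A \<and> (y, fib x) \<in> G"
    and "\<And>x y. R x y \<Longrightarrow> x \<notin> A \<Longrightarrow> y \<notin> A \<Longrightarrow> fib x = fib y"
  shows "alt_walk G (fib (hd ws)) (project A fib ws)"
    and "last (fib (hd ws) # map snd (project A fib ws)) = fib (last ws)"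
    and "\<And>x. x \<in> set ws \<Longrightarrow> x \<notin> A \<Longrightarrow> fib x \<in> insert (fib (hd ws)) (snd ` set (project A fib ws))"
proof -
  have "alt_walk G (fib (hd ws)) (project A fib ws)
    \<and> last (fib (hd ws) # map snd (project A fib ws)) = fib (last ws)
    \<and> (\<forall>x \<in> set ws. x \<notin> A \<longrightarrow> fib x \<in> insert (fib (hd ws)) (snd ` set (project A fib ws)))"
    using assms(1-4)
  proof (induction "length ws" arbitrary: ws rule: less_induct)
    case less
    show ?case
    proof (cases ws)
      case Nil
      then show ?thesis using less.prems by simp
    next
      case (Cons x xs)
      show ?thesis
      proof (cases xs)
        case Nil
        then show ?thesis using Cons by simp
      next
        case xs: (Cons y ys)
        have R: "R x y" and x: "x \<notin> A" using less.prems Cons xs by auto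
        show ?thesis
        proof (cases "y \<in> A")
          case False
          have IH: "alt_walk G (fib (hd xs)) (project A fib xs)
            \<and> last (fib (hd xs) # map snd (project A fib xs)) = fib (last xs)
            \<and> (\<forall>x \<in> set xs. x \<notin> A \<longrightarrow> fib x \<in> insert (fib (hd xs)) (snd ` set (project A fib xs)))"
            using less.prems Cons xs False by (intro less.hyps) auto
          then show ?thesis using Cons xs x False assms(7)[OF R x False] by auto
        next
          case True
          then obtain z zs where ys: "ys = z # zs" using less.prems Cons xs by (cases ys) auto
          have R2: "R y z" using less.prems Cons xs ys by auto
          have z: "z \<notin> A" "(y, fib z) \<in> G" using assms(5)[OF R2 True] by auto
          have yx: "(y, fib x) \<in> G" using assms(6)[OF R True] by auto
          have IH: "alt_walk G (fib (hd ys)) (project A fib ys)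
            \<and> last (fib (hd ys) # map snd (project A fib ys)) = fib (last ys)
            \<and> (\<forall>x \<in> set ys. x \<notin> A \<longrightarrow> fib x \<in> insert (fib (hd ys)) (snd ` set (project A fib ys)))"
            using less.prems Cons xs ys z by (intro less.hyps) auto
          then show ?thesis using Cons xs ys x z yx True by auto
        qed
      qed
    qed
  qed
  then show "alt_walk G (fib (hd ws)) (project A fib ws)"
    and "last (fib (hd ws) # map snd (project A fib ws)) = fib (last ws)"
    and "\<And>x. x \<in> set ws \<Longrightarrow> x \<notin> A \<Longrightarrow> fib x \<in> insert (fib (hd ws)) (snd ` set (project A fib ws))"
    by blast+
qed

section \<open>Twin blow-ups of bipartite graphs\<close>

text \<open>The vertex \<open>f (b, 0)\<close> represents \<open>b\<close>, and \<open>f (b, 1), \<dots>, f (b, 4)\<close> are the possible twins: they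
  form two pairs, from each of which Constructor will receive one.\<close>
locale twin_blowup =
  fixes n :: nat and k :: nat and A :: "nat set" and B :: "nat set" and G :: "(nat \<times> nat) set"
    and f :: "nat \<times> nat \<Rightarrow> nat"
  assumes k: "k \<ge> 3"
    and A: "A \<subseteq> {..<n}"
    and G: "G \<subseteq> A \<times> B"
    and inj_f: "inj_on f (B \<times> {..<5})"
    and f: "f ` (B \<times> {..<5}) \<subseteq> {..<n} - A"
    and no_short: "no_short_cycle k G"
begin

definition fib :: "nat \<Rightarrow> nat" where
  "fib x = fst (the_inv_into (B \<times> {..<5}) f x)"

lemma f_eq_iff: "b \<in> B \<Longrightarrow> b' \<in> B \<Longrightarrow> i < 5 \<Longrightarrow> i' < 5 \<Longrightarrow> f (b, i) = f (b', i') \<longleftrightarrow> b = b' \<and> i = i'"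
  using inj_onD[OF inj_f, of "(b, i)" "(b', i')"] by auto

lemma fib_f [simp]: "b \<in> B \<Longrightarrow> i < 5 \<Longrightarrow> fib (f (b, i)) = b"
  using the_inv_into_f_f[OF inj_f, of "(b, i)"] by (simp add: fib_def)

lemma f_notin_A [simp]: "b \<in> B \<Longrightarrow> i < 5 \<Longrightarrow> f (b, i) \<notin> A"
  and f_less: "b \<in> B \<Longrightarrow> i < 5 \<Longrightarrow> f (b, i) < n"
  using f by auto

lemma finite_B: "finite B"
proof -
  have "finite (f ` (B \<times> {..<5}))" using f by (rule finite_subset) simp
  then have "finite (B \<times> {..<5::nat})" using inj_f finite_imageD by blast
  then show ?thesis by (rule finite_cartesian_productD1) (simp add: lessThan_empty_iff)
qed

lemma finite_G: "finite G"
  using finite_subset[OF G] finite_subset[OF A] finite_B by blast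

text \<open>The graph in which \<open>f (b, 0)\<close> and \<open>f (b, j b)\<close> both inherit the neighbours of \<open>b\<close>. The edges to all
  four possible twins are present, because Constructor claims some of them before she
  chooses \<open>j\<close>; the superfluous ones are pendant and lie on no cycle.\<close>
definition target :: "(nat \<Rightarrow> nat) \<Rightarrow> nat set set" where
  "target j = (\<lambda>(a, b). {a, f (b, 0)}) ` G \<union> (\<lambda>(a, b). {a, f (b, j b)}) ` G
     \<union> (\<lambda>(b, i). {f (b, 0), f (b, i)}) ` (B \<times> {1..<5})"

context
  fixes j :: "nat \<Rightarrow> nat"
  assumes j: "\<And>b. b \<in> B \<Longrightarrow> j b \<in> {1..<5}"
begin

lemma target_cases:
  assumes "{x, y} \<in> target j"
  obtains a b i where "(a, b) \<in> G" "i = 0 \<or> i = j b" "x = a \<and> y = f (b, i) \<or> y = a \<and> x = f (b, i)"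
  | b i where "b \<in> B" "i \<in> {1..<5}" "x = f (b, 0) \<and> y = f (b, i) \<or> y = f (b, 0) \<and> x = f (b, i)"
proof -
  consider a b where "(a, b) \<in> G" "{x, y} = {a, f (b, 0)}"
    | a b where "(a, b) \<in> G" "{x, y} = {a, f (b, j b)}"
    | b i where "b \<in> B" "i \<in> {1..<5}" "{x, y} = {f (b, 0), f (b, i)}"
    using assms by (auto simp: target_def)
  then show ?thesis
  proof cases
    case 1
    then show ?thesis using that(1)[of a b 0] by (auto simp: doubleton_eq_iff)
  next
    case 2
    then show ?thesis using that(1)[of a b "j b"] by (auto simp: doubleton_eq_iff)
  next
    case 3
    then show ?thesis using that(2)[of b i] by (auto simp: doubleton_eq_iff)
  qed
qed

lemma j_less:
  assumes "b \<in> B" shows "j b < 5" "0 < j b"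
  using j[OF assms] by auto

lemma target_A_side:
  assumes "{x, y} \<in> target j" "x \<in> A"
  shows "y \<notin> A \<and> (x, fib y) \<in> G"
  using assms(1)
proof (cases rule: target_cases)
  case (1 a b i)
  then have "b \<in> B" "i < 5" "a \<in> A" using G j_less by auto
  then show ?thesis using 1 assms(2) by auto
next
  case (2 b i)
  then show ?thesis using assms(2) by auto
qed

lemma target_B_side:
  assumes "{x, y} \<in> target j" "x \<notin> A" "y \<notin> A"
  shows "fib x = fib y"
  using assms(1)
proof (cases rule: target_cases)
  case (1 a b i)
  then have "a \<in> A" using G by auto
  then show ?thesis using 1 assms by auto
next
  case (2 b i)
  then show ?thesis by auto
qed

lemma target_pendant:
  assumes "{x, y} \<in> target j" "b \<in> B" "i < 5" "x = f (b, i)" "i \<noteq> 0" "i \<noteq> j b"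
  shows "y = f (b, 0)"
  using assms(1)
proof (cases rule: target_cases)
  case (1 a b' i')
  then have *: "b' \<in> B" "i' < 5" "a \<in> A" using G j_less by auto
  then have "x = f (b', i')" using 1 assms by auto
  then show ?thesis using assms * 1 f_eq_iff[of b b' i i'] by auto
next
  case (2 b' i')
  then show ?thesis using assms f_eq_iff[of b b' i i'] f_eq_iff[of b b' i 0] by auto
qed

lemma target_vertex:
  assumes "{x, y} \<in> target j" "x \<notin> A"
  shows "\<exists>b i. b \<in> B \<and> i < 5 \<and> x = f (b, i)"
  using assms(1)
proof (cases rule: target_cases)
  case (1 a b i)
  then have "b \<in> B" "i < 5" "a \<in> A" using G j_less by auto
  then show ?thesis using 1 assms by auto
next
  case (2 b i)
  then have "x = f (b, 0) \<or> x = f (b, i)" "i < 5" "(0::nat) < 5" by auto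
  then show ?thesis using 2(1) by blast
qed

text \<open>Project a \<open>C\<^sub>2\<^sub>k\<close> to \<open>G\<close>. The vertices of \<open>A\<close> on it are distinct, and at most \<open>k\<close> in number since no
  two of them are adjacent. If the projection meets two different \<open>b\<close>, then
  \<open>simple_alt_cycle_exists\<close> produces a cycle of \<open>G\<close> of length at most \<open>2k\<close>. Otherwise all
  other vertices of the cycle lie over one \<open>b\<close>; not being pendant they are among the two twins, and
  so the cycle has at most \<open>k + 2 < 2k\<close> vertices.\<close>
lemma target_free: "free_of (cycle_graph (2 * k)) ({..<n}, target j)"
proof (rule ccontr)
  define L where "L = 2 * k"
  have L: "L \<ge> 6" using k by (simp add: L_def)
  assume "\<not> ?thesis"
  then obtain v where inj: "inj_on v {..<L}"
    and edge: "\<And>i. i < L \<Longrightarrow> {v i, v (Suc i mod L)} \<in> target j"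
    using L by (subst (asm) free_of_cycle_graph_iff) (auto simp: L_def)
  define w where "w = (\<lambda>i. v (i mod L))"
  have w_edge: "{w i, w (Suc i)} \<in> target j" for i
    using edge[of "i mod L"] L by (simp add: w_def mod_Suc_eq)
  have w_eq: "w x = w y \<longleftrightarrow> x mod L = y mod L" for x y
    using inj_on_eq_iff[OF inj, of "x mod L" "y mod L"] L by (auto simp: w_def)
  have w_A: "w (Suc i) \<notin> A" if "w i \<in> A" for i
    using target_A_side[OF w_edge that] by simp
  \<comment> \<open>The walk is started outside \<open>A\<close>, so that it begins and ends in a fibre.\<close>
  define s where "s = (if w 0 \<in> A then 1 else 0 :: nat)"
  have s: "w s \<notin> A" using w_A[of 0] by (auto simp: s_def)
  define ws where "ws = map w [s..<Suc (s + L)]"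
  have hd_ws: "hd ws = w s" unfolding ws_def by (simp add: upt_rec hd_map)
  have last_ws: "last ws = w s" by (simp add: ws_def w_def)
  have butlast_ws: "butlast ws = map w [s..<s + L]" by (simp add: ws_def)
  have succ: "successively (\<lambda>x y. {x, y} \<in> target j) ws"
    unfolding successively_conv_nth
  proof (intro allI impI)
    fix i assume "Suc i < length ws"
    then have "ws ! i = w (s + i)" "ws ! Suc i = w (Suc (s + i))"
      by (auto simp: ws_def nth_append simp del: upt_Suc)
    then show "{ws ! i, ws ! Suc i} \<in> target j" using w_edge by simp
  qed
  define xs where "xs = project A fib ws"
  have proj: "alt_walk G (fib (hd ws)) xs"
    "last (fib (hd ws) # map snd xs) = fib (last ws)"
    "\<And>x. x \<in> set ws \<Longrightarrow> x \<notin> A \<Longrightarrow> fib x \<in> insert (fib (hd ws)) (snd ` set xs)"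
    unfolding xs_def
    by (rule project_alt_walk[where G = G, OF succ];
        (simp add: hd_ws last_ws s)?;
        use target_A_side target_B_side in \<open>fastforce simp: ws_def insert_commute\<close>)+
  have inj_w: "inj_on w {s..<s + L}"
  proof (rule inj_onI)
    have *: "x = y" if "x \<le> y" "s \<le> x" "y < s + L" "w x = w y" for x y
    proof (rule ccontr)
      assume "x \<noteq> y"
      moreover have "L dvd y - x" using that w_eq[of y x] by (simp add: mod_eq_dvd_iff_nat)
      ultimately show False using that dvd_imp_le[of L "y - x"] by linarith
    qed
    fix x y assume "x \<in> {s..<s + L}" "y \<in> {s..<s + L}" "w x = w y"
    then show "x = y" using *[of x y] *[of y x] by (cases "x \<le> y") auto
  qed
  have fst_xs: "map fst xs = filter (\<lambda>x. x \<in> A) (map w [s..<s + L])"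
    by (simp add: xs_def map_fst_project butlast_ws)
  have dist: "distinct (map fst xs)"
    using inj_w by (auto simp: fst_xs distinct_map intro: distinct_filter)
  have alternate: "successively (\<lambda>x y. x \<in> A \<longrightarrow> y \<notin> A) ws"
    by (rule successively_mono[OF succ]) (use target_A_side in blast)
  have two_A: "2 * length (filter (\<lambda>x. x \<in> A) ws) \<le> L"
  proof -
    have "ws \<noteq> []" "length ws = Suc L" by (simp_all add: ws_def)
    then show ?thesis
      using length_filter_no_consecutive[of A ws] alternate s
      by (simp add: hd_ws last_ws)
  qed
  have "length xs \<le> length (filter (\<lambda>x. x \<in> A) ws)"
  proof -
    have "length xs = length (filter (\<lambda>x. x \<in> A) (butlast ws))"
      by (metis butlast_ws fst_xs length_map)
    also have "\<dots> \<le> length (filter (\<lambda>x. x \<in> A) ws)" by (simp add: ws_def)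
    finally show ?thesis .
  qed
  then have len_xs: "length xs \<le> k" using two_A by (simp add: L_def)
  define X where "X = w ` {s..<s + L}"
  have X_ws: "X \<subseteq> set ws" by (auto simp: X_def ws_def)
  show False
  proof (cases "\<exists>x\<in>X. x \<notin> A \<and> fib x \<noteq> fib (w s)")
    case True
    then obtain p where p: "p \<in> set xs" "snd p \<noteq> fib (w s)"
      using proj(3) X_ws by (fastforce simp: hd_ws)
    then have "xs \<noteq> []" by auto
    then have l: "snd (last xs) = fib (w s)" using proj(2) by (simp add: last_ws last_map)
    then have "alt_cycle G xs" using proj(1) \<open>xs \<noteq> []\<close> by (simp add: alt_cycle_def hd_ws)
    then obtain ys where "alt_cycle G ys" "distinct (map fst ys)" "distinct (map snd ys)"
      "2 \<le> length ys" "length ys \<le> length xs"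
      using simple_alt_cycle_exists[OF _ dist, where x = p and y = "last xs"] p l \<open>xs \<noteq> []\<close> by auto
    then show False using no_short len_xs unfolding no_short_cycle_def by fastforce
  next
    case False
    define b where "b = fib (w s)"
    have "x \<in> {f (b, 0), f (b, j b)}" if x: "x \<in> X" "x \<notin> A" for x
    proof -
      obtain i where i: "x = w i" using x by (auto simp: X_def)
      obtain b' i' where b': "b' \<in> B" "i' < 5" "x = f (b', i')"
        using target_vertex[OF w_edge] x i by blast
      have "b' = b" using False x b' by (auto simp: b_def)
      have e1: "{x, w (Suc i)} \<in> target j" using w_edge i by simp
      have "w (Suc (i + L - 1)) = w i" using L by (simp add: w_eq)
      then have e2: "{x, w (i + L - 1)} \<in> target j"
        using w_edge[of "i + L - 1"] i by (simp add: insert_commute)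
      have "\<not> L dvd (i + L - 1) - Suc i" using L dvd_imp_le[of L "L - 2"] by auto
      then have "w (Suc i) \<noteq> w (i + L - 1)"
        using L mod_eq_dvd_iff_nat[of "Suc i" "i + L - 1" L] unfolding w_eq by linarith
      then show ?thesis
        using target_pendant[OF e1 b'] target_pendant[OF e2 b'] b' \<open>b' = b\<close>
        by (cases "i' = 0 \<or> i' = j b'") auto
    qed
    moreover have "set (map fst xs) = {x \<in> X. x \<in> A}"
      by (simp only: fst_xs set_filter) (simp add: X_def)
    ultimately have "X \<subseteq> {f (b, 0), f (b, j b)} \<union> fst ` set xs" by auto
    then have "card X \<le> card ({f (b, 0), f (b, j b)} \<union> fst ` set xs)" by (intro card_mono) auto
    also have "\<dots> \<le> card {f (b, 0), f (b, j b)} + card (fst ` set xs)" by (rule card_Un_le)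
    also have "card (fst ` set xs) \<le> length xs"
      by (metis card_length length_map set_map)
    also have "card {f (b, 0), f (b, j b)} \<le> 2" by (simp add: card_insert_if)
    finally have "card X \<le> 2 + length xs" by simp
    moreover have "card X = L" using inj_w by (simp add: X_def card_image)
    ultimately show False using len_xs L by (simp add: L_def)
  qed
qed

end

end

context twin_blowup
begin

text \<open>Blocker's moves in the first two stages number at most about \<open>2|B| + |G|/2\<close>, and each of them spoils
  at most one of the roughly \<open>|G|\<close> triples \<open>(a, b, r)\<close>, where \<open>r\<close> names one of the two candidate twins of \<open>b\<close>. So
  for one of the two values of \<open>r\<close> about a quarter of all edges \<open>ab\<close> of \<open>G\<close> can still be completed to
  triangles, up to terms linear in \<open>|B|\<close>, and half of these will be.\<close>
lemma card_edges_le_g_num: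
  "card G \<le> 8 * g_num n (complete_graph 3) (cycle_graph (2 * k)) + 6 * card B + 5"
proof -
  let ?F = "cycle_graph (2 * k)"
  let ?K = "edges (complete_graph n)"
  \<comment> \<open>The constant 2 is chosen so that the rounding in the two halvings to come is absorbed.\<close>
  define t where "t = (card G - 6 * card B + 2) div 8"
  define spoke where "spoke = (\<lambda>((b, r), s). {f (b, 0), f (b, 1 + 2 * r + (if s then 1 else 0 :: nat))})"
  define J where "J = B \<times> {0, 1 :: nat}"
  have A_less: "a < n" "a \<in> A" "b \<in> B" if "(a, b) \<in> G" for a b using that A G by auto
  have ne: "a \<noteq> f (b, i)" if "(a, b') \<in> G" "b \<in> B" "i < 5" for a b b' i
    using that G f_notin_A by auto
  have leaf: "1 + 2 * r + (if s then 1 else 0) \<in> {1..<5::nat}" if "r \<in> {0, 1}" for r s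
    using that by auto
  have "t \<le> game_value n (complete_graph 3) ?F Constructor {} {}"
  \<comment> \<open>First stage: one twin out of each of two pairs for every \<open>b\<close>, so that two candidates remain.\<close>
  proof (rule pairing[of J spoke])
    show "finite J" using finite_B by (simp add: J_def card_cartesian_product)
    show "inj_on spoke (J \<times> UNIV)"
    proof (rule inj_onI)
      fix x y assume "x \<in> J \<times> UNIV" "y \<in> J \<times> UNIV" and eq: "spoke x = spoke y"
      then obtain b r s b' r' s' where xy: "x = ((b, r), s)" "y = ((b', r'), s')"
        "b \<in> B" "b' \<in> B" "r \<in> {0, 1}" "r' \<in> {0, 1}" by (fastforce simp: J_def)
      let ?i = "1 + 2 * r + (if s then 1 else 0)" and ?i' = "1 + 2 * r' + (if s' then 1 else 0)"
      have i: "?i < 5" "?i' < 5" "?i \<noteq> 0" "?i' \<noteq> 0" using xy leaf by auto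
      have "{f (b, 0), f (b, ?i)} = {f (b', 0), f (b', ?i')}" using eq by (simp add: spoke_def xy)
      then have "f (b, ?i) = f (b', ?i')"
        using f_eq_iff[of b b' 0 ?i'] xy i by (auto simp: doubleton_eq_iff)
      then have "b = b'" "?i = ?i'" using f_eq_iff[OF xy(3,4) i(1,2)] by auto
      then show "x = y" using xy by (auto split: if_splits; presburger)
    qed
    show spoke_K: "spoke ` (J \<times> UNIV) \<subseteq> ?K - ({} \<union> {})"
      using f_less f_eq_iff leaf by (fastforce simp: J_def spoke_def intro!: edge_in_complete)
    show "free_of ?F ({..<n}, {} \<union> spoke ` (J \<times> UNIV))"
      by (rule free_of_mono[OF target_free[of "\<lambda>_. 1"]])
        (use leaf in \<open>force simp: J_def spoke_def target_def\<close>)+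
    show "finite {}" by simp
    fix \<sigma> and B1 :: "nat set set" assume B1: "finite B1" "card B1 \<le> card ({} :: nat set set) + card J"
    define C1 where "C1 = (\<lambda>x. spoke (x, \<sigma> x)) ` J"
    \<comment> \<open>The candidate twin \<open>j r b\<close> is the one that Constructor got from the \<open>r\<close>-th pair.\<close>
    define j where "j = (\<lambda>r b. 1 + 2 * r + (if \<sigma> (b, r) then 1 else 0 :: nat))"
    have j: "j r b \<in> {1..<5}" if "r \<in> {0, 1}" for r b
      using leaf[OF that] by (simp add: j_def)
    have C1: "C1 = (\<lambda>(b, r). {f (b, 0), f (b, j r b)}) ` J"
      unfolding C1_def by (rule image_cong) (auto simp: spoke_def j_def)
    have C1_target: "C1 \<subseteq> target j'" for j'
      using j by (fastforce simp: C1 J_def target_def)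
    have C1_A: "a \<notin> A" if "e \<in> C1" "a \<in> e" for a e
      using that j by (fastforce simp: C1 J_def)
    \<comment> \<open>Second stage: half of the surviving edges from \<open>A\<close> to the first copies.\<close>
    define S2 where "S2 = (\<lambda>(a, b). {a, f (b, 0)}) ` G - B1"
    define h where "h = card S2 div 2"
    have cardJ: "card J = 2 * card B" by (simp add: J_def card_cartesian_product)
    have inj0: "inj_on (\<lambda>(a, b). {a, f (b, i b)}) G" if "\<And>b. b \<in> B \<Longrightarrow> i b < 5" for i
    proof (rule inj_onI, clarify)
      fix a b a' b' assume G': "(a, b) \<in> G" "(a', b') \<in> G" and eq: "{a, f (b, i b)} = {a', f (b', i b')}"
      note B' = A_less(3)[OF G'(1)] A_less(3)[OF G'(2)]
      have "a \<noteq> f (b', i b')" using ne[OF G'(1) B'(2)] that[OF B'(2)] by blast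
      then have "a = a'" "f (b, i b) = f (b', i b')"
        using eq by (auto simp: doubleton_eq_iff)
      then show "a = a' \<and> b = b'" using f_eq_iff[OF B'] that B' by blast
    qed
    have "card G - card B1 \<le> card S2"
    proof -
      have "card ((\<lambda>(a, b). {a, f (b, 0)}) ` G) = card G" using inj0[of "\<lambda>_. 0"] by (simp add: card_image)
      then show ?thesis unfolding S2_def using diff_card_le_card_Diff[OF B1(1), of "(\<lambda>(a, b). {a, f (b, 0)}) ` G"] by simp
    qed
    then have S2_card: "card G \<le> card S2 + 2 * card B" using B1(2) cardJ by simp
    show "t \<le> game_value n (complete_graph 3) ?F Constructor ({} \<union> (\<lambda>x. spoke (x, \<sigma> x)) ` J) B1"
      unfolding Un_empty_left C1_def[symmetric]
    proof (rule claim_half[of S2])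
      show "finite S2" using finite_G by (simp add: S2_def)
      show S2_sub: "S2 \<subseteq> ?K - (C1 \<union> B1)"
        using C1_A A_less f_less ne by (fastforce simp: S2_def intro!: edge_in_complete)
      have "C1 \<union> S2 \<subseteq> target (\<lambda>_. 1)" using C1_target by (auto simp: S2_def target_def)
      then show "free_of ?F ({..<n}, C1 \<union> S2)"
        by (intro free_of_mono[OF target_free[of "\<lambda>_. 1"]]) auto
      show "finite B1" by (rule B1(1))
      fix S B2 :: "nat set set" assume S: "S \<subseteq> S2" "card S = card S2 div 2" and B2: "finite B2"
        "card B2 \<le> card B1 + card S2 div 2"
      define E where "E = {(a, b) \<in> G. {a, f (b, 0)} \<in> S}"
      have E: "E \<subseteq> G" by (auto simp: E_def)
      have cardE: "card E = h"
      proof -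
        have "(\<lambda>(a, b). {a, f (b, 0)}) ` E = S"
          using S(1) by (auto simp: E_def S2_def image_iff)
        moreover have "inj_on (\<lambda>(a, b). {a, f (b, 0)}) E"
          using inj0[of "\<lambda>_. 0"] E by (auto intro: inj_on_subset)
        ultimately show ?thesis using card_image S(2) h_def by metis
      qed
      \<comment> \<open>The edges of \<open>G\<close> that can still be completed to a triangle if the \<open>r\<close>-th twins are used.\<close>
      define T where "T = (\<lambda>r. {(a, b) \<in> E. {a, f (b, j r b)} \<notin> B2})"
      have finE: "finite E" using finite_subset[OF E finite_G] .
      have jl: "j r b < 5" "j r b \<noteq> 0" if "r \<in> {0, 1}" for r b using j[OF that, of b] by auto
      have lost: "card (E - T 0) + card (E - T 1) \<le> card B2"
      proof -
        let ?\<phi> = "\<lambda>r (a, b). {a, f (b, j r b)}"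
        have inj: "inj_on (?\<phi> r) (E - T r)" if "r \<in> {0, 1}" for r
          using inj0[of "j r"] jl that E by (meson Diff_subset inj_on_subset)
        have "?\<phi> 0 ` (E - T 0) \<inter> ?\<phi> 1 ` (E - T 1) = {}"
        proof -
          have "{a, f (b, j 0 b)} \<noteq> {a', f (b', j 1 b')}" if G': "(a, b) \<in> G" "(a', b') \<in> G" for a b a' b'
          proof
            assume "{a, f (b, j 0 b)} = {a', f (b', j 1 b')}"
            moreover have "a \<noteq> f (b', j 1 b')"
              using ne[OF G'(1) A_less(3)[OF G'(2)]] jl by simp
            ultimately have "f (b, j 0 b) = f (b', j 1 b')"
              by (auto simp: doubleton_eq_iff)
            then have "b = b'" "j 0 b = j 1 b'"
              using f_eq_iff[OF A_less(3)[OF G'(1)] A_less(3)[OF G'(2)]] jl by auto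
            then show False by (auto simp: j_def split: if_splits)
          qed
          then show ?thesis using E by fastforce
        qed
        then have "card (E - T 0) + card (E - T 1) = card (?\<phi> 0 ` (E - T 0) \<union> ?\<phi> 1 ` (E - T 1))"
          using inj finE by (subst card_Un_disjoint) (auto simp: card_image)
        also have "\<dots> \<le> card B2" using B2(1) by (intro card_mono) (auto simp: T_def)
        finally show ?thesis .
      qed
      have T_sub: "T r \<subseteq> E" for r by (auto simp: T_def)
      have "card (E - T r) + card (T r) = h" for r
        using card_Diff_subset[OF finite_subset[OF T_sub finE] T_sub, of r] card_mono[OF finE T_sub, of r]
          cardE by simp
      from this[of 0] this[of 1]
      have "2 * h \<le> card (T 0) + card (T 1) + card B2" using lost by linarith
      then have h_le: "h \<le> card (T 0) + card (T 1) + 2 * card B"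
        using B1(2) B2(2) cardJ by (simp add: h_def)
      then obtain r where r: "r \<in> {0, 1}" and Tr: "h \<le> 2 * card (T r) + 2 * card B"
      proof (cases "card (T 0) \<le> card (T 1)")
        case True
        then show ?thesis using that[of 1] h_le by simp
      next
        case False
        then show ?thesis using that[of 0] h_le by simp
      qed
      have TG: "(a, b) \<in> G" if "(a, b) \<in> T r" for a b using that T_sub E by blast
      \<comment> \<open>Third stage: the missing edges \<open>{a, f (b, j r b)}\<close> for the better value of \<open>r\<close>.\<close>
      have "card (T r) div 2 \<le> game_value n (complete_graph 3) ?F Constructor (C1 \<union> S) B2"
      proof (rule claim_indexed_triangles[where \<phi> = "\<lambda>(a, b). {a, f (b, j r b)}" and a = "\<lambda>(a, b). f (b, 0)"])
        show "C1 \<union> S \<subseteq> ?K"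
        proof -
          have "C1 \<subseteq> ?K"
            using spoke_K unfolding C1_def by blast
          then show ?thesis using S2_sub S(1) by blast
        qed
        show "(\<lambda>(a, b). {a, f (b, j r b)}) ` T r \<subseteq> ?K - (C1 \<union> S \<union> B2)"
        proof clarify
          fix a b assume ab: "(a, b) \<in> T r"
          then have G': "(a, b) \<in> G" by (rule TG)
          have "{a, f (b, j r b)} \<in> ?K"
            using A_less[OF G'] f_less ne[OF G'] jl[OF r] by (auto intro!: edge_in_complete)
          moreover have "{a, f (b, j r b)} \<notin> C1" using C1_A A_less[OF G'] by blast
          moreover have "{a, f (b, j r b)} \<notin> S"
          proof
            assume "{a, f (b, j r b)} \<in> S"
            then obtain a' b' where G2: "(a', b') \<in> G" and "{a, f (b, j r b)} = {a', f (b', 0)}"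
              using S(1) by (auto simp: S2_def)
            then have "f (b, j r b) = f (b', 0)"
              using ne[OF G2 A_less(3)[OF G'], of "j r b"] jl[OF r] by (auto simp: doubleton_eq_iff)
            then show False using f_eq_iff[OF A_less(3)[OF G'] A_less(3)[OF G2]] jl[OF r] by auto
          qed
          moreover have "{a, f (b, j r b)} \<notin> B2" using ab by (simp add: T_def)
          ultimately show "{a, f (b, j r b)} \<in> ?K - (C1 \<union> S \<union> B2)" by blast
        qed
        have "C1 \<union> S \<union> (\<lambda>(a, b). {a, f (b, j r b)}) ` T r \<subseteq> target (j r)"
          using C1_target[of "j r"] S(1) TG by (force simp: S2_def target_def)
        then show "free_of ?F ({..<n}, C1 \<union> S \<union> (\<lambda>(a, b). {a, f (b, j r b)}) ` T r)"
          by (rule free_of_mono[OF target_free[OF j[OF r]]])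
        show "finite B2" by (rule B2(1))
        show "inj_on (\<lambda>(a, b). {a, f (b, j r b)}) (T r)"
          using inj0[of "j r"] jl r T_sub[of r] E by (meson inj_on_subset subset_trans)
        show "inj_on (\<lambda>x. insert (case x of (a, b) \<Rightarrow> f (b, 0)) (case x of (a, b) \<Rightarrow> {a, f (b, j r b)})) (T r)"
        proof (rule inj_onI, clarify)
          fix a b a' b' assume T': "(a, b) \<in> T r" "(a', b') \<in> T r"
            and eq: "{f (b, 0), a, f (b, j r b)} = {f (b', 0), a', f (b', j r b')}"
          note G' = TG[OF T'(1)] TG[OF T'(2)]
          note facts = A_less[OF G'(1)] A_less[OF G'(2)] jl[OF r] f_notin_A
          have "a \<in> {f (b', 0), a', f (b', j r b')}" using eq by blast
          then have "a = a'" using facts by auto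
          moreover have "f (b, 0) \<in> {f (b', 0), a', f (b', j r b')}" using eq by blast
          then have "b = b'" using facts f_eq_iff[of b b' 0 0] f_eq_iff[of b b' 0 "j r b'"] by auto
          ultimately show "a = a' \<and> b = b'" by blast
        qed
        fix x assume x: "x \<in> T r"
        then obtain a b where ab: "x = (a, b)" "(a, b) \<in> T r" by (cases x) auto
        note G' = TG[OF ab(2)]
        have "{f (b, 0), a} \<in> C1 \<union> S" using ab by (auto simp: T_def E_def insert_commute)
        moreover have "{f (b, 0), f (b, j r b)} \<in> C1"
          using A_less[OF G'] r by (auto simp: C1 J_def)
        moreover have "f (b, 0) \<noteq> a" "a \<noteq> f (b, j r b)" "f (b, 0) \<noteq> f (b, j r b)"
          using ne[OF G' A_less(3)[OF G'], of 0] ne[OF G' A_less(3)[OF G'], of "j r b"] jl[OF r, of b]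
            f_eq_iff[OF A_less(3)[OF G'] A_less(3)[OF G'], of 0 "j r b"] by auto
        ultimately show "insert (case x of (a, b) \<Rightarrow> f (b, 0)) (case x of (a, b) \<Rightarrow> {a, f (b, j r b)})
            \<in> triangles (insert (case x of (a, b) \<Rightarrow> {a, f (b, j r b)}) (C1 \<union> S))"
          by (simp add: ab insert_in_triangles_iff)
      qed
      moreover have "t \<le> card (T r) div 2"
        using Tr S2_card unfolding t_def h_def by linarith
      ultimately show "t \<le> game_value n (complete_graph 3) ?F Constructor (C1 \<union> S) B2" by simp
    qed
  qed
  then have "t \<le> g_num n (complete_graph 3) ?F" by (simp add: g_num_def)
  then show ?thesis unfolding t_def by linarith
qed

end

section \<open>Bipartite subgraphs of extremal graphs\<close>

lemma large_fibre_exists: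
  assumes "finite X" "finite C" "C \<noteq> {}" "h ` X \<subseteq> C"
  shows "\<exists>c\<in>C. card X \<le> card C * card {x \<in> X. h x = c}"
proof (rule ccontr)
  assume "\<not> ?thesis"
  then have less: "card C * card {x \<in> X. h x = c} < card X" if "c \<in> C" for c
    using that by (meson not_le)
  have "X = (\<Union>c\<in>C. {x \<in> X. h x = c})" using assms(4) by auto
  then have "card X \<le> (\<Sum>c\<in>C. card {x \<in> X. h x = c})"
    using card_UN_le[OF assms(2), of "\<lambda>c. {x \<in> X. h x = c}"] by simp
  then have "card C * card X \<le> (\<Sum>c\<in>C. card C * card {x \<in> X. h x = c})"
    by (simp flip: sum_distrib_left)
  also have "\<dots> < (\<Sum>c\<in>C. card X)"
    using assms less by (intro sum_strict_mono) auto
  finally show False by simp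
qed

text \<open>Vertices are added one at a time, each on the side that contains fewer of its neighbours.\<close>
lemma large_cut_exists:
  assumes "finite V" "E \<subseteq> {e. e \<subseteq> V \<and> card e = 2}"
  shows "\<exists>S\<subseteq>V. card E \<le> 2 * card {(a, b). {a, b} \<in> E \<and> a \<in> S \<and> b \<notin> S}"
  using assms
proof (induction V arbitrary: E rule: finite_induct)
  case empty
  then have "E = {}" by auto
  then show ?case by simp
next
  case (insert x V)
  define cut where "cut = (\<lambda>S E. {(a :: 'a, b :: 'a). {a, b} \<in> E \<and> a \<in> S \<and> b \<notin> S})"
  define E0 where "E0 = {e \<in> E. x \<notin> e}"
  define N where "N = {y \<in> V. {x, y} \<in> E}"
  have "E0 \<subseteq> {e. e \<subseteq> V \<and> card e = 2}" using insert.prems by (auto simp: E0_def)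
  then obtain S where S: "S \<subseteq> V" "card E0 \<le> 2 * card (cut S E0)"
    using insert.IH[of E0] unfolding cut_def by blast
  have fin_cut: "finite (cut T D)" if "D \<subseteq> {e. e \<subseteq> insert x V \<and> card e = 2}" for T D
    by (rule finite_subset[of _ "insert x V \<times> insert x V"])
      (use that insert.hyps in \<open>auto simp: cut_def\<close>)
  have finN: "finite N" using insert.hyps by (simp add: N_def)
  have finE: "finite E"
    by (rule finite_subset[OF insert.prems]) (simp add: insert.hyps)
  have "E \<subseteq> E0 \<union> (\<lambda>y. {x, y}) ` N"
  proof
    fix e assume e: "e \<in> E"
    show "e \<in> E0 \<union> (\<lambda>y. {x, y}) ` N"
    proof (cases "x \<in> e")
      case True
      obtain a b where "e = {a, b}" "a \<noteq> b" "a \<in> insert x V" "b \<in> insert x V"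
        using insert.prems e by (auto simp: card_2_iff)
      then show ?thesis using True e by (auto simp: N_def insert_commute)
    qed (use e E0_def in auto)
  qed
  then have "card E \<le> card (E0 \<union> (\<lambda>y. {x, y}) ` N)"
    using finE finN by (intro card_mono) (auto simp: E0_def)
  also have "\<dots> \<le> card E0 + card N"
    by (rule order.trans[OF card_Un_le]) (simp add: card_image_le finN)
  finally have E_le: "card E \<le> card E0 + card N" .
  have splitN: "card N = card (N \<inter> S) + card (N - S)"
    using finN by (metis card_Int_Diff)
  have E0: "E0 \<subseteq> {e. e \<subseteq> insert x V \<and> card e = 2}" using insert.prems by (auto simp: E0_def)
  show ?case
  proof (cases "card (N - S) \<le> card (N \<inter> S)")
    case True
    have "cut S E0 \<union> (\<lambda>y. (y, x)) ` (N \<inter> S) \<subseteq> cut S E"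
      using S(1) insert.hyps(2) by (auto simp: cut_def E0_def N_def insert_commute)
    then have "card (cut S E0 \<union> (\<lambda>y. (y, x)) ` (N \<inter> S)) \<le> card (cut S E)"
      by (intro card_mono fin_cut insert.prems)
    moreover have "card (cut S E0 \<union> (\<lambda>y. (y, x)) ` (N \<inter> S)) = card (cut S E0) + card (N \<inter> S)"
      using fin_cut[OF E0] finN
      by (subst card_Un_disjoint) (auto simp: cut_def E0_def card_image inj_on_def)
    ultimately have "card E \<le> 2 * card (cut S E)" using S(2) E_le splitN True by linarith
    then show ?thesis using S(1) unfolding cut_def by blast
  next
    case False
    have "cut S E0 \<union> (\<lambda>y. (x, y)) ` (N - S) \<subseteq> cut (insert x S) E"
      using S(1) insert.hyps(2) by (auto simp: cut_def E0_def N_def)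
    then have "card (cut S E0 \<union> (\<lambda>y. (x, y)) ` (N - S)) \<le> card (cut (insert x S) E)"
      by (intro card_mono fin_cut insert.prems)
    moreover have "card (cut S E0 \<union> (\<lambda>y. (x, y)) ` (N - S)) = card (cut S E0) + card (N - S)"
      using fin_cut[OF E0] finN
      by (subst card_Un_disjoint) (auto simp: cut_def E0_def card_image inj_on_def)
    ultimately have "card E \<le> 2 * card (cut (insert x S) E)" using S(2) E_le splitN False by linarith
    then show ?thesis using S(1) unfolding cut_def by blast
  qed
qed

lemma card_residue_class_le:
  fixes n m i :: nat
  assumes "m > 0"
  shows "card {x. x < n \<and> x mod m = i} \<le> n div m + 1"
proof -
  have "{x. x < n \<and> x mod m = i} \<subseteq> (\<lambda>q. q * m + i) ` {..n div m}"
  proof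
    fix x assume "x \<in> {x. x < n \<and> x mod m = i}"
    then have "x = (x div m) * m + i" "x div m \<le> n div m"
      using div_mult_mod_eq[of x m] by (auto intro: div_le_mono)
    then show "x \<in> (\<lambda>q. q * m + i) ` {..n div m}" by blast
  qed
  then have "card {x. x < n \<and> x mod m = i} \<le> card ((\<lambda>q. q * m + i) ` {..n div m})"
    by (intro card_mono) auto
  also have "\<dots> \<le> n div m + 1" using card_image_le[of "{..n div m}"] by fastforce
  finally show ?thesis .
qed

text \<open>Both sides of a large cut are divided into residue classes modulo 12, and the densest of the
  144 pairs of classes is kept. The classes are small enough to leave room for five copies of one
  of them.\<close>
lemma balanced_bipartite_subgraph:
  assumes "E \<subseteq> edges (complete_graph n)"
  obtains A B G where "A \<subseteq> {..<n}" "B \<subseteq> {..<n}" "A \<inter> B = {}" "G \<subseteq> A \<times> B"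
    "card A \<le> n div 12 + 1" "card B \<le> n div 12 + 1"
    "\<And>a b. (a, b) \<in> G \<Longrightarrow> {a, b} \<in> E" "card E \<le> 288 * card G"
proof -
  obtain S where S: "S \<subseteq> {..<n}"
    and cut: "card E \<le> 2 * card {(a, b). {a, b} \<in> E \<and> a \<in> S \<and> b \<notin> S}"
    using large_cut_exists[of "{..<n}" E] assms by (auto simp: complete_graph_def)
  define X where "X = {(a, b). {a, b} \<in> E \<and> a \<in> S \<and> b \<notin> S}"
  have X: "X \<subseteq> {..<n} \<times> {..<n}" using assms by (auto simp: X_def complete_graph_def)
  let ?C = "{..<12::nat} \<times> {..<12::nat}"
  obtain c where c: "c \<in> ?C"
    and le: "card X \<le> card ?C * card {x \<in> X. (\<lambda>(a, b). (a mod 12, b mod 12)) x = c}"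
    using large_fibre_exists[of X ?C "\<lambda>(a, b). (a mod 12, b mod 12)"] finite_subset[OF X]
    by (fastforce simp: lessThan_empty_iff simp del: card_cartesian_product card_lessThan)
  obtain i j where ij: "c = (i, j)" by fastforce
  define A where "A = {x \<in> S. x mod 12 = i}"
  define B where "B = {x \<in> {..<n} - S. x mod 12 = j}"
  define G where "G = {x \<in> X. (\<lambda>(a, b). (a mod 12, b mod 12)) x = c}"
  show thesis
  proof (rule that[of A B G])
    have "card A \<le> card {x. x < n \<and> x mod 12 = i}"
      by (intro card_mono) (use S in \<open>auto simp: A_def\<close>)
    then show "card A \<le> n div 12 + 1" using card_residue_class_le[of 12 n i] by simp
    have "card B \<le> card {x. x < n \<and> x mod 12 = j}"
      by (intro card_mono) (auto simp: B_def)
    then show "card B \<le> n div 12 + 1" using card_residue_class_le[of 12 n j] by simp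
    show "card E \<le> 288 * card G" using cut le by (simp add: X_def G_def)
  qed (use S X in \<open>auto simp: A_def B_def G_def X_def ij\<close>)
qed

lemma alt_walk_nth:
  assumes "alt_walk G b xs" "q < length xs"
  shows "xs ! q \<in> G \<and> (fst (xs ! q), if q = 0 then b else snd (xs ! (q - 1))) \<in> G"
  using assms
proof (induction xs arbitrary: b q)
  case (Cons x xs)
  obtain a b' where x: "x = (a, b')" by fastforce
  show ?case
  proof (cases q)
    case 0
    then show ?thesis using Cons.prems x by simp
  next
    case (Suc p)
    then show ?thesis using Cons.IH[of b' p] Cons.prems x by (cases p) auto
  qed
qed simp

lemma no_short_cycle_if_free:
  assumes free: "\<And>F. F \<in> even_cycles_upto k \<Longrightarrow> free_of F ({..<n}, E)"
    and G: "G \<subseteq> A \<times> B" "A \<subseteq> {..<n}" "B \<subseteq> {..<n}" "A \<inter> B = {}"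
    and E: "\<And>a b. (a, b) \<in> G \<Longrightarrow> {a, b} \<in> E"
  shows "no_short_cycle k G"
  unfolding no_short_cycle_def
proof (intro allI impI)
  fix xs assume xs: "alt_cycle G xs \<and> distinct (map fst xs) \<and> distinct (map snd xs) \<and> 2 \<le> length xs"
  define m where "m = length xs"
  have m: "2 \<le> m" using xs by (simp add: m_def)
  have walk: "alt_walk G (snd (last xs)) xs" and ne: "xs \<noteq> []" using xs by (auto simp: alt_cycle_def)
  have mem: "xs ! q \<in> G" if "q < m" for q
    using alt_walk_nth[OF walk] that by (simp add: m_def)
  have closing: "(fst (xs ! (Suc q mod m)), snd (xs ! q)) \<in> G" if "q < m" for q
  proof (cases "Suc q = m")
    case True
    then have "length xs - 1 = q" by (simp add: m_def flip: True)
    then have "snd (last xs) = snd (xs ! q)" using ne by (simp add: last_conv_nth)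
    then show ?thesis using alt_walk_nth[OF walk, of 0] True ne by auto
  next
    case False
    then show ?thesis using alt_walk_nth[OF walk, of "Suc q"] that by (simp add: m_def)
  qed
  define v where "v = (\<lambda>i. if even i then fst (xs ! (i div 2)) else snd (xs ! (i div 2)))"
  have fst_A: "fst (xs ! q) \<in> A" and snd_B: "snd (xs ! q) \<in> B" if "q < m" for q
    using mem[OF that] G(1) by (auto simp: mem_Times_iff)
  show "k < length xs"
  proof (rule ccontr)
    assume "\<not> k < length xs"
    then have "cycle_graph (2 * m) \<in> even_cycles_upto k"
      using m by (auto simp: even_cycles_upto_def m_def)
    then have "free_of (cycle_graph (2 * m)) ({..<n}, E)" by (rule free)
    then show False
    proof (rule cycle_in_free_graphD[of _ _ _ v])
      show "3 \<le> 2 * m" using m by simp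
      show "inj_on v {..<2 * m}"
      proof (rule inj_onI)
        fix i j assume ij: "i \<in> {..<2 * m}" "j \<in> {..<2 * m}" and eq: "v i = v j"
        then have i: "i div 2 < m" and j: "j div 2 < m" by auto
        have par: "even i = even j"
          using eq fst_A[OF i] fst_A[OF j] snd_B[OF i] snd_B[OF j] G(4) by (auto simp: v_def split: if_splits)
        have "i div 2 = j div 2"
        proof (cases "even i")
          case True
          then have "map fst xs ! (i div 2) = map fst xs ! (j div 2)" using eq par i j by (simp add: v_def m_def)
          then show ?thesis using xs i j by (subst (asm) nth_eq_iff_index_eq) (auto simp: m_def)
        next
          case False
          then have "map snd xs ! (i div 2) = map snd xs ! (j div 2)" using eq par i j by (simp add: v_def m_def)
          then show ?thesis using xs i j by (subst (asm) nth_eq_iff_index_eq) (auto simp: m_def)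
        qed
        then show "i = j" using par by (metis even_two_times_div_two odd_two_times_div_two_succ)
      qed
      show "v ` {..<2 * m} \<subseteq> {..<n}"
      proof clarify
        fix i assume "i < 2 * m"
        then have "i div 2 < m" by auto
        then show "v i < n" using fst_A snd_B G(2,3) by (auto simp: v_def)
      qed
      fix i assume i: "i < 2 * m"
      show "{v i, v (Suc i mod (2 * m))} \<in> E"
      proof (cases "even i")
        case True
        then obtain q where q: "i = 2 * q" by (elim evenE)
        then have "Suc i < 2 * m" using i by simp
        then have "{v i, v (Suc i mod (2 * m))} = {fst (xs ! q), snd (xs ! q)}" using q by (simp add: v_def)
        then show ?thesis using E[of "fst (xs ! q)" "snd (xs ! q)"] mem[of q] q i by simp
      next
        case False
        then obtain q where q: "i = 2 * q + 1" by (elim oddE)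
        then have "Suc i = 2 * Suc q" by simp
        then have "Suc i mod (2 * m) = 2 * (Suc q mod m)" by (simp only: mult_mod_right)
        then have "{v i, v (Suc i mod (2 * m))} = {fst (xs ! (Suc q mod m)), snd (xs ! q)}"
          using q by (auto simp: v_def)
        then show ?thesis using E[OF closing[of q]] q i by simp
      qed
    qed
  qed
qed

lemma no_short_cycle_star: "no_short_cycle k (A \<times> {b})"
  unfolding no_short_cycle_def
proof (intro allI impI, elim conjE)
  fix xs assume "alt_cycle (A \<times> {b}) xs" and dist: "distinct (map snd xs)" and len: "2 \<le> length xs"
  then have "alt_walk (A \<times> {b}) (snd (last xs)) xs" by (simp add: alt_cycle_def)
  then have "snd (xs ! q) = b" if "q < length xs" for q
    using alt_walk_nth that by fastforce
  moreover have "0 < length xs" "1 < length xs" using len by auto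
  ultimately have "map snd xs ! 0 = map snd xs ! 1" by simp
  then show "k < length xs" using dist len by (subst (asm) nth_eq_iff_index_eq) auto
qed

text \<open>The strategy loses a multiple of \<open>|B|\<close>, which is harmless if \<open>G\<close> has at least \<open>16n\<close> edges. This can be
  arranged unless the extremal number is linear in \<open>n\<close>, and then a star, where \<open>|B| = 1\<close>, is good enough.\<close>
lemma ex_num_le_g_num_of_ge_3:
  assumes k: "k \<ge> 3" and n: "n \<ge> 32"
  shows "ex_num n (even_cycles_upto k) \<le> 73728 * g_num n (complete_graph 3) (cycle_graph (2 * k))"
proof -
  define g where "g = g_num n (complete_graph 3) (cycle_graph (2 * k))"
  show ?thesis
  proof (cases "ex_num n (even_cycles_upto k) \<le> 4608 * n")
    case True
    have "inj_on snd ({0::nat} \<times> {..<5::nat})" by (auto simp: inj_on_def)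
    then have "twin_blowup n k {5..<n} {0} ({5..<n} \<times> {0}) snd"
      using k n by unfold_locales (auto simp: no_short_cycle_star)
    from twin_blowup.card_edges_le_g_num[OF this] have "n - 5 \<le> 8 * g + 11" by (simp add: g_def card_cartesian_product)
    then have "n \<le> 16 * g" using n by linarith
    then show ?thesis using True by (simp add: g_def)
  next
    case False
    have empty: "free_of F ({..<n}, {})" if "F \<in> even_cycles_upto k" for F
      using that by (auto simp: even_cycles_upto_def intro!: free_of_cycle_empty)
    obtain E where E: "E \<subseteq> edges (complete_graph n)"
      "\<And>F. F \<in> even_cycles_upto k \<Longrightarrow> free_of F ({..<n}, E)"
      "card E = ex_num n (even_cycles_upto k)"
      using ex_num_attained[of "even_cycles_upto k" n, OF empty] by blast
    obtain A B G where ABG: "A \<subseteq> {..<n}" "B \<subseteq> {..<n}" "A \<inter> B = {}" "G \<subseteq> A \<times> B"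
      and small: "card A \<le> n div 12 + 1" "card B \<le> n div 12 + 1"
      and GE: "\<And>a b. (a, b) \<in> G \<Longrightarrow> {a, b} \<in> E" and big: "card E \<le> 288 * card G"
      using balanced_bipartite_subgraph[OF E(1)] by blast
    have fin: "finite A" "finite B" using ABG(1,2) finite_subset by blast+
    have "card (B \<times> {..<5::nat}) \<le> card ({..<n} - A)"
      using fin small n ABG(1) by (simp add: card_cartesian_product card_Diff_subset)
    then obtain f where f: "inj_on f (B \<times> {..<5::nat})" "f ` (B \<times> {..<5}) \<subseteq> {..<n} - A"
      using inj_on_iff_card_le[of "B \<times> {..<5::nat}" "{..<n} - A"] fin by auto
    have "twin_blowup n k A B G f"
      using k ABG f no_short_cycle_if_free[OF E(2) ABG(4,1,2,3) GE] by unfold_locales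
    from twin_blowup.card_edges_le_g_num[OF this] have "card G \<le> 8 * g + 6 * card B + 5" by (simp add: g_def)
    moreover have "16 * n \<le> card G" using big False E(3) by linarith
    moreover have "card B \<le> n" using small(2) n by linarith
    ultimately have "card G \<le> 16 * g" using n by linarith
    then show ?thesis using big E(3) by (simp add: g_def)
  qed
qed

section \<open>Primes in multiplicative intervals\<close>

lemma prod_primes_dvd:
  assumes "finite P" "\<And>p. p \<in> P \<Longrightarrow> prime (p :: nat) \<and> p dvd m"
  shows "\<Prod>P dvd m"
  using assms
proof (induction P rule: finite_induct)
  case (insert p P)
  have "coprime p (\<Prod>P)"
  proof (rule prod_coprime_right)
    fix q assume "q \<in> P"
    then have "prime p" "prime q" "p \<noteq> q" using insert.prems insert.hyps(2) by auto
    then show "coprime p q" by (rule primes_coprime)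
  qed
  then show ?case using insert by (simp add: divides_mult)
qed simp

text \<open>The primes in \<open>(N, 2N]\<close> all divide the binomial coefficient of \<open>2N\<close> over \<open>N\<close>, which is at most \<open>4\<^sup>N\<close>;
  for powers of two this can be iterated.\<close>
lemma primorial_pow2_le: "\<Prod>{p :: nat. prime p \<and> p \<le> 2 ^ j} \<le> 4 ^ 2 ^ j"
proof (induction j)
  case 0
  have "\<not> (prime p \<and> p \<le> 2 ^ 0)" for p :: nat using prime_ge_2_nat[of p] by auto
  then have "{p :: nat. prime p \<and> p \<le> 2 ^ 0} = {}" by blast
  then have "\<Prod>{p :: nat. prime p \<and> p \<le> 2 ^ 0} = 1" by (simp only: prod.empty)
  then show ?case by (simp only: one_le_power)
next
  case (Suc j)
  define N :: nat where "N = 2 ^ j"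
  let ?P = "{p. prime p \<and> N < p \<and> p \<le> 2 * N}"
  have "\<Prod>?P dvd (2 * N) choose N"
  proof (rule prod_primes_dvd)
    show "finite ?P" by (rule finite_subset[of _ "{..2 * N}"]) auto
    fix p assume p: "p \<in> ?P"
    then have prime: "prime p" by simp
    have "(fact (2 * N) :: nat) = fact N * fact N * ((2 * N) choose N)"
      using binomial_fact_lemma[of N "2 * N"] by simp
    moreover have "p dvd fact (2 * N)"
      using p prime_dvd_fact_iff[OF prime] by simp
    ultimately have "p dvd fact N * fact N * ((2 * N) choose N)" by metis
    then have "p dvd fact N \<or> p dvd (2 * N) choose N"
      using prime_dvd_mult_iff[OF prime] by blast
    moreover have "\<not> p dvd fact N" using p prime_dvd_fact_iff[OF prime] by simp
    ultimately show "prime p \<and> p dvd (2 * N) choose N" using prime by blast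
  qed
  then have "\<Prod>?P \<le> (2 * N) choose N" by (rule dvd_imp_le) simp
  also have "\<dots> \<le> 2 ^ (2 * N)" by (rule binomial_le_pow2)
  finally have new: "\<Prod>?P \<le> 4 ^ N" by (simp add: power_mult)
  have N2: "2 ^ Suc j = 2 * N" by (simp add: N_def)
  have split: "{p. prime p \<and> p \<le> 2 * N} = {p. prime p \<and> p \<le> N} \<union> ?P" by auto
  have "\<Prod>({p. prime p \<and> p \<le> N} \<union> ?P) = \<Prod>{p. prime p \<and> p \<le> N} * \<Prod>?P"
  proof (rule prod.union_disjoint)
    show "finite {p. prime p \<and> p \<le> N}" by (rule finite_subset[of _ "{..N}"]) auto
    show "finite ?P" by (rule finite_subset[of _ "{..2 * N}"]) auto
  qed auto
  also have "\<dots> \<le> 4 ^ N * 4 ^ N"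
    using Suc.IH new by (intro mult_le_mono) (simp_all only: N_def)
  also have "\<dots> = 4 ^ (2 * N)" by (simp only: power_add mult_2)
  finally show ?case unfolding N2 split .
qed

text \<open>The reciprocals of the numbers \<open>D m j = (m + 1) (m choose j)\<close> are the entries of Leibniz' harmonic
  triangle, which satisfy \<open>1 / D m (j + 1) = 1 / D (m - 1) j - 1 / D m j\<close>. Multiplied by the least common
  multiple, the right-hand side is an integer by induction, hence so is the left-hand side.\<close>
lemma leibniz_dvd_Lcm:
  assumes "j \<le> m"
  shows "(m + 1) * (m choose j) dvd Lcm {1..m + 1 :: nat}"
  using assms
proof (induction j arbitrary: m)
  case 0
  then show ?case by (auto intro: dvd_Lcm)
next
  case (Suc j)
  define L where "L = Lcm {1..m + 1 :: nat}"
  obtain m' where m: "m = Suc m'" using Suc.prems by (cases m) auto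
  have "(m' + 1) * (m' choose j) dvd Lcm {1..m' + 1}" using Suc m by simp
  also have "\<dots> dvd L" unfolding L_def by (rule Lcm_subset) (simp add: m)
  finally obtain u where u: "L = (m' + 1) * (m' choose j) * u" by (elim dvdE)
  obtain v where v: "L = (m + 1) * (m choose j) * v"
    using Suc.IH[of m] Suc.prems unfolding L_def by (auto elim: dvdE)
  have "L \<noteq> 0" unfolding L_def by (simp add: Lcm_0_iff)
  then have pos: "L > 0" "m choose j > 0" "m' choose j > 0" using Suc.prems m by auto
  have 1: "Suc j * (m choose Suc j) = m * (m' choose j)"
    using binomial_absorption[of j m] by (simp only: m diff_Suc_1)
  have 2: "(m - j) * (m choose j) = m * (m' choose j)"
    using binomial_absorb_comp[of m j] by (simp only: m diff_Suc_1)
  have u': "L = (m - j) * (m choose j) * u" using u 2 m by simp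
  have "(m choose j) * ((m + 1) * v) = (m choose j) * ((m - j) * u)"
    using u' v by (simp only: mult.assoc mult.commute mult.left_commute)
  then have eq: "(m + 1) * v = (m - j) * u"
    using pos(2) by (simp only: mult_cancel1) simp
  have "(m + 1) * (m choose Suc j) * (u - v) = L"
  proof -
    have "v \<le> u"
    proof -
      have "(m + 1) * v \<le> (m + 1) * u" using eq by (metis diff_le_self le_add1 le_trans mult_le_mono1)
      then show ?thesis by (simp only: mult_le_cancel1)
    qed
    have "(m + 1) * (u - v) = (m + 1) * u - (m - j) * u"
      using eq by (simp only: diff_mult_distrib2)
    also have "\<dots> = ((m + 1) - (m - j)) * u" by (simp only: diff_mult_distrib)
    also have "(m + 1) - (m - j) = Suc j" using Suc.prems by simp
    finally have "(m + 1) * (u - v) = Suc j * u" .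
    then have "(m + 1) * (m choose Suc j) * (u - v) = Suc j * (m choose Suc j) * u"
      by (metis mult.assoc mult.commute)
    also have "\<dots> = L" using 1 u m by simp
    finally show ?thesis .
  qed
  then show ?case unfolding L_def by (metis dvd_triv_left)
qed

lemma prime_power_dvd_Lcm_le:
  assumes "prime p" "e > 0" "p ^ e dvd Lcm {1..m :: nat}"
  shows "p ^ e \<le> m"
  using assms(3)
proof (induction m)
  case 0
  then show ?case using assms by (auto dest: not_prime_unit)
next
  case (Suc m)
  have "{1..Suc m} = insert (Suc m) {1..m}" by auto
  then have "p ^ e dvd lcm (Suc m) (Lcm {1..m})" using Suc.prems by simp
  moreover have nz: "Lcm {1..m} \<noteq> 0" by (simp add: Lcm_0_iff)
  ultimately have "e \<le> multiplicity p (lcm (Suc m) (Lcm {1..m}))"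
    using assms(1) by (intro multiplicity_geI) (auto simp: lcm_eq_0_iff not_prime_unit)
  also have "\<dots> = max (multiplicity p (Suc m)) (multiplicity p (Lcm {1..m}))"
    using assms(1) nz by (intro multiplicity_lcm) auto
  finally have "p ^ e dvd Suc m \<or> p ^ e dvd Lcm {1..m}"
    by (auto simp: le_max_iff_disj intro: multiplicity_dvd')
  then show ?case using Suc.IH by (auto dest: dvd_imp_le)
qed

lemma pow2_gt_linear: "i \<ge> 5 \<Longrightarrow> 4 * i + 8 < (2 :: nat) ^ i"
  by (induction i rule: dec_induct) auto

text \<open>Let \<open>M = 4n + 1\<close> with \<open>n = 2\<^sup>j\<close>. The least common multiple of \<open>1, \<dots>, M\<close> is at least \<open>4\<^bsup>2n\<^esup>\<close>. All its
  prime powers are at most \<open>M\<close>, and primes above \<open>\<surd>M\<close> occur only once; so, if there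
  were no prime between \<open>n\<close> and \<open>M\<close>, it would be at most \<open>M\<^bsup>\<surd>M\<^esup>\<close> times the product of the primes up
  to \<open>n\<close>, which is at most \<open>4\<^sup>n\<close>. For large \<open>j\<close> this is too small.\<close>
lemma prime_between_pow2:
  assumes "j \<ge> 10"
  shows "\<exists>q :: nat. prime q \<and> 2 ^ j < q \<and> q \<le> 4 * 2 ^ j + 1"
proof (rule ccontr)
  assume no: "\<not> ?thesis"
  define n :: nat where "n = 2 ^ j"
  define M where "M = 4 * n + 1"
  define L where "L = Lcm {1..M}"
  \<comment> \<open>The number \<open>s\<close> is a power of two between \<open>\<surd>M\<close> and \<open>2\<surd>M\<close>.\<close>
  define i where "i = j div 2"
  define s :: nat where "s = 2 ^ (i + 2)"
  have n1: "n \<ge> 1" by (simp add: n_def)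
  have L0: "L > 0" by (auto simp: L_def intro!: Nat.gr0I)
  have j: "j \<le> 2 * i + 1" "2 * i \<le> j" by (auto simp: i_def)
  have M_less: "M < s\<^sup>2"
  proof -
    have "n \<le> 2 ^ (2 * i + 1)" unfolding n_def using j(1) by (intro power_increasing) auto
    also have "\<dots> = 2 * 2 ^ (2 * i)" by simp
    finally have "M \<le> 8 * 2 ^ (2 * i) + 1" by (simp add: M_def)
    also have "\<dots> < 16 * 2 ^ (2 * i)"
    proof -
      have "(1 :: nat) \<le> 2 ^ (2 * i)" by simp
      then show ?thesis by linarith
    qed
    also have "\<dots> = 2 ^ (4 + 2 * i)" by (simp add: power_add)
    also have "4 + 2 * i = (i + 2) * 2" by simp
    also have "2 ^ ((i + 2) * 2) = s\<^sup>2" by (simp only: s_def power_mult)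
    finally show ?thesis .
  qed
  have pf: "prime p \<and> p \<le> n \<and> p ^ multiplicity p L \<le> (if p \<le> s then M else p)"
    if "p \<in> prime_factors L" for p
  proof -
    have p: "prime p" and mult: "multiplicity p L > 0"
      using that L0 by (auto simp: prime_factors_multiplicity)
    have le: "p ^ multiplicity p L \<le> M"
      using prime_power_dvd_Lcm_le[OF p mult, of M] by (simp add: multiplicity_dvd L_def)
    have "p \<le> M" using prime_power_dvd_Lcm_le[OF p, of 1 M] that by (auto simp: L_def)
    then have "p \<le> n" using no p unfolding n_def M_def by (meson not_le)
    moreover have "p ^ multiplicity p L \<le> p" if "s < p"
    proof -
      have "s\<^sup>2 < p\<^sup>2" using that by (intro power_strict_mono) auto
      then have "p ^ multiplicity p L < p ^ 2" using le M_less by linarith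
      then have "multiplicity p L < 2" using prime_gt_1_nat[OF p] by (simp add: power_strict_increasing_iff)
      then have "multiplicity p L = 1" using mult by simp
      then show ?thesis by simp
    qed
    ultimately show ?thesis using p le by auto
  qed
  have "4 ^ (2 * n) \<le> (2 * (2 * n) + 1) * ((2 * (2 * n)) choose (2 * n))"
  proof -
    have "real (4 ^ (2 * n)) \<le> real ((2 * (2 * n)) * ((2 * (2 * n)) choose (2 * n)))"
      using central_binomial_lower_bound[of "2 * n"] n1 by (simp add: field_simps)
    then have "4 ^ (2 * n) \<le> (2 * (2 * n)) * ((2 * (2 * n)) choose (2 * n))" by (simp only: of_nat_le_iff)
    then show ?thesis by simp
  qed
  also have "\<dots> \<le> L"
    using leibniz_dvd_Lcm[of "2 * n" "2 * (2 * n)"] L0 by (intro dvd_imp_le) (auto simp: L_def M_def)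
  also have "L = (\<Prod>p\<in>prime_factors L. p ^ multiplicity p L)"
    using L0 by (rule prime_factorization_nat)
  also have "\<dots> \<le> (\<Prod>p\<in>prime_factors L. if p \<le> s then M else p)"
    using pf by (intro prod_mono) auto
  also have "\<dots> \<le> (\<Prod>p\<in>{p. prime p \<and> p \<le> n}. (if p \<le> s then M else 1) * p)"
  proof -
    have fin: "finite {p. prime p \<and> p \<le> n}" by (rule finite_subset[of _ "{..n}"]) auto
    have "(\<Prod>p\<in>prime_factors L. if p \<le> s then M else p)
        \<le> (\<Prod>p\<in>prime_factors L. (if p \<le> s then M else 1) * p)"
      by (intro prod_mono) (auto simp: prime_factors_multiplicity prime_gt_0_nat Suc_le_eq)
    also have "\<dots> \<le> (\<Prod>p\<in>{p. prime p \<and> p \<le> n}. (if p \<le> s then M else 1) * p)"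
    proof (intro dvd_imp_le prod_dvd_prod_subset fin)
      show "0 < (\<Prod>p\<in>{p. prime p \<and> p \<le> n}. (if p \<le> s then M else 1) * p)"
        by (auto simp: M_def prime_gt_0_nat intro!: prod_pos)
    qed (use pf in blast)
    finally show ?thesis .
  qed
  also have "\<dots> = (\<Prod>p\<in>{p. prime p \<and> p \<le> n}. if p \<le> s then M else 1) * \<Prod>{p. prime p \<and> p \<le> n}"
    by (rule prod.distrib)
  also have "\<dots> \<le> M ^ s * 4 ^ n"
  proof (rule mult_le_mono)
    have fin: "finite {p. prime p \<and> p \<le> n}" by (rule finite_subset[of _ "{..n}"]) auto
    have "(\<Prod>p\<in>{p. prime p \<and> p \<le> n}. if p \<le> s then M else 1)
       = (\<Prod>p\<in>{p \<in> {p. prime p \<and> p \<le> n}. p \<le> s}. M)"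
      using fin by (intro prod.inter_filter[symmetric])
    also have "\<dots> = M ^ card {p \<in> {p. prime p \<and> p \<le> n}. p \<le> s}" by simp
    also have "\<dots> \<le> M ^ s"
    proof (rule power_increasing)
      have "card {p \<in> {p. prime p \<and> p \<le> n}. p \<le> s} \<le> card {1..s}"
        by (intro card_mono) (auto simp: prime_gt_0_nat Suc_le_eq)
      then show "card {p \<in> {p. prime p \<and> p \<le> n}. p \<le> s} \<le> s" by simp
    qed (simp add: M_def)
    finally show "(\<Prod>p\<in>{p. prime p \<and> p \<le> n}. if p \<le> s then M else 1) \<le> M ^ s" .
    show "\<Prod>{p. prime p \<and> p \<le> n} \<le> 4 ^ n" using primorial_pow2_le[of j] by (simp add: n_def)
  qed
  finally have "4 ^ n * 4 ^ n \<le> M ^ s * 4 ^ n" by (simp add: power_add mult_2)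
  then have "4 ^ n \<le> M ^ s" by simp
  also have "\<dots> \<le> (2 ^ (j + 3)) ^ s" using n1 by (intro power_mono) (auto simp: M_def n_def power_add)
  finally have "(2::nat) ^ (2 * n) \<le> 2 ^ ((j + 3) * s)" by (simp add: power_mult)
  then have "2 * n \<le> (j + 3) * s" by simp
  also have "\<dots> \<le> (2 * i + 4) * s" using j by simp
  finally have "2 * n \<le> 4 * ((2 * i + 4) * 2 ^ i)" by (simp add: s_def)
  moreover have "2 ^ i * 2 ^ i \<le> n"
    unfolding n_def power_add[symmetric] using j by (intro power_increasing) auto
  ultimately have "2 ^ i * 2 ^ i \<le> (4 * i + 8) * (2::nat) ^ i" by (simp add: algebra_simps)
  then have "2 ^ i \<le> 4 * i + 8" by simp
  moreover have "5 \<le> i" using assms by (simp add: i_def)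
  ultimately show False using pow2_gt_linear[of i] by simp
qed

section \<open>The maximum size of a four-cycle-free graph\<close>

text \<open>Two vertices have at most one common neighbour. Counting paths of length two by their middle
  vertex and by their ends gives \<open>\<Sum> (deg v)\<^sup>2 \<le> 2|E| + n\<^sup>2\<close>, and the Cauchy-Schwarz inequality bounds the left-hand
  side from below by \<open>(2|E|)\<^sup>2 / n\<close>.\<close>
lemma card_squared_le_of_C4_free:
  assumes "E \<subseteq> edges (complete_graph n)" and free: "free_of (cycle_graph 4) ({..<n}, E)"
  shows "(card E)\<^sup>2 \<le> n ^ 3"
proof -
  have E: "\<And>e. e \<in> E \<Longrightarrow> card e = 2" "\<And>e. e \<in> E \<Longrightarrow> e \<subseteq> {..<n}"
    using assms(1) by (auto simp: complete_graph_def)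
  define N where "N = (\<lambda>v. {y. {v, y} \<in> E})"
  have finN: "finite (N v)" for v
    by (rule finite_subset[of _ "{..<n}"]) (use E(2) in \<open>auto simp: N_def\<close>)
  have codegree: "v = w" if "x \<in> N v" "y \<in> N v" "x \<in> N w" "y \<in> N w" "x \<noteq> y" for v w x y
  proof (rule ccontr)
    assume "v \<noteq> w"
    define c where "c = (\<lambda>i :: nat. if i = 0 then v else if i = 1 then x else if i = 2 then w else y)"
    have four: "{..<4::nat} = {0, 1, 2, 3}" by auto
    have edges: "{v, x} \<in> E" "{v, y} \<in> E" "{w, x} \<in> E" "{w, y} \<in> E" using that by (auto simp: N_def)
    then have less: "v < n" "x < n" "w < n" "y < n" using E(2)[OF edges(1)] E(2)[OF edges(4)] by auto
    have "v \<noteq> x" "v \<noteq> y" "w \<noteq> x" "w \<noteq> y"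
      using edges[THEN E(1)] by auto
    then have "inj_on c {..<4}" using \<open>v \<noteq> w\<close> \<open>x \<noteq> y\<close> by (simp add: four c_def)
    moreover have "c ` {..<4} \<subseteq> {..<n}" using less by (auto simp: four c_def)
    moreover have "{c i, c (Suc i mod 4)} \<in> E" if "i < 4" for i
    proof -
      have "i = 0 \<or> i = 1 \<or> i = 2 \<or> i = 3" using that by auto
      then show ?thesis using edges by (elim disjE) (simp_all add: c_def insert_commute)
    qed
    ultimately show False by (intro cycle_in_free_graphD[OF free]) auto
  qed
  have "(\<Sum>v<n. (card (N v))\<^sup>2) \<le> (\<Sum>v<n. card (N v)) + n\<^sup>2"
  proof -
    define D where "D = (SIGMA v:{..<n}. {(x, y). x \<in> N v \<and> y \<in> N v \<and> x \<noteq> y})"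
    have fin: "finite {(x, y). x \<in> N v \<and> y \<in> N v \<and> x \<noteq> y}" for v
      by (rule finite_subset[of _ "N v \<times> N v"]) (auto simp: finN)
    have eq: "(card (N v))\<^sup>2 = card (N v) + card {(x, y). x \<in> N v \<and> y \<in> N v \<and> x \<noteq> y}" for v
    proof -
      have "N v \<times> N v = (\<lambda>x. (x, x)) ` N v \<union> {(x, y). x \<in> N v \<and> y \<in> N v \<and> x \<noteq> y}" by auto
      then have "card (N v \<times> N v) = card ((\<lambda>x. (x, x)) ` N v) + card {(x, y). x \<in> N v \<and> y \<in> N v \<and> x \<noteq> y}"
        using finN fin by (simp only:) (rule card_Un_disjoint, auto)
      then show ?thesis by (simp add: card_cartesian_product power2_eq_square card_image inj_on_def)
    qed
    have "inj_on snd D"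
    proof (rule inj_onI)
      fix p q assume pq: "p \<in> D" "q \<in> D" "snd p = snd q"
      obtain v x y w where "p = (v, x, y)" "q = (w, x, y)" using pq(3) by (cases p; cases q) auto
      then show "p = q" using pq(1,2) codegree[of x v y w] by (simp add: D_def)
    qed
    moreover have "snd ` D \<subseteq> {..<n} \<times> {..<n}" using E(2) by (fastforce simp: D_def N_def)
    ultimately have "card D \<le> card ({..<n} \<times> {..<n})" by (intro card_inj_on_le) auto
    moreover have "card D = (\<Sum>v<n. card {(x, y). x \<in> N v \<and> y \<in> N v \<and> x \<noteq> y})"
      using fin by (simp add: D_def)
    ultimately have "(\<Sum>v<n. card {(x, y). x \<in> N v \<and> y \<in> N v \<and> x \<noteq> y}) \<le> n\<^sup>2"
      by (simp add: power2_eq_square)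
    then show ?thesis by (simp only: eq sum.distrib)
  qed
  moreover have deg: "(\<Sum>v<n. card (N v)) = 2 * card E"
    using sum_degrees[OF assms(1)] by (simp add: N_def)
  ultimately have sq: "(\<Sum>v<n. (card (N v))\<^sup>2) \<le> 2 * card E + n\<^sup>2" by simp
  have "real ((2 * card E)\<^sup>2) \<le> real ((\<Sum>v<n. (card (N v))\<^sup>2) * n)"
    using sum_squared_le_sum_of_squares[of "\<lambda>v. real (card (N v))" "{..<n}"] deg
    by (simp flip: of_nat_sum of_nat_power of_nat_mult)
  then have "(2 * card E)\<^sup>2 \<le> (\<Sum>v<n. (card (N v))\<^sup>2) * n" by (simp only: of_nat_le_iff)
  also have "\<dots> \<le> (2 * card E + n\<^sup>2) * n" using sq by (rule mult_right_mono) simp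
  finally have main: "4 * (card E)\<^sup>2 \<le> 2 * card E * n + n ^ 3"
    by (simp add: power2_eq_square power3_eq_cube algebra_simps)
  show ?thesis
  proof (cases "card E \<le> n")
    case True
    then have "(card E)\<^sup>2 \<le> n\<^sup>2" by (rule power_mono) simp
    also have "\<dots> \<le> n ^ 3" by (cases "n = 0") (auto intro: power_increasing)
    finally show ?thesis .
  next
    case False
    then have "card E * n \<le> (card E)\<^sup>2" by (simp add: power2_eq_square)
    then show ?thesis using main by linarith
  qed
qed

section \<open>Four-cycle-free graphs from an affine plane\<close>

text \<open>Non-vertical lines \<open>y = p x + c\<close> and points of the affine plane over the field with \<open>q\<close> elements.\<close>
datatype vert = Line nat nat | Point nat nat

locale plane =
  fixes q h n :: nat
  assumes q: "prime q" and h: "4 * h < q" and n: "2 * q\<^sup>2 \<le> n"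
begin

text \<open>The sum of two slopes lies strictly between \<open>2 h\<close> and \<open>q\<close>, so it is never congruent to a slope:
  the set is sum-free modulo \<open>q\<close>.\<close>
definition slopes :: "nat set" where "slopes = {h + 1..2 * h}"

fun valid :: "vert \<Rightarrow> bool" where
  "valid (Line p c) \<longleftrightarrow> p \<in> slopes \<and> c < q"
| "valid (Point x y) \<longleftrightarrow> x < 4 * h \<and> y < q"

fun enc :: "vert \<Rightarrow> nat" where
  "enc (Line p c) = p * q + c"
| "enc (Point x y) = q\<^sup>2 + x * q + y"

definition on :: "nat \<Rightarrow> nat \<Rightarrow> nat \<Rightarrow> nat \<Rightarrow> bool" where
  "on p c x y \<longleftrightarrow> int q dvd int y - int p * int x - int c"

text \<open>The point with abscissa in the left half and the point with abscissa in the right half lie on a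
  common line of slope \<open>p\<close>, and the abscissae differ by \<open>l p\<close>. Allowing only steps from left to
  right makes the graph on the points bipartite; without this restriction two steps could be taken in
  either order, which would give a \<open>C\<^sub>4\<close>.\<close>
definition step :: "nat \<Rightarrow> nat \<Rightarrow> nat \<Rightarrow> nat \<Rightarrow> nat \<Rightarrow> nat \<Rightarrow> bool" where
  "step l p x y x' y' \<longleftrightarrow> p \<in> slopes \<and> x < 2 * h \<and> 2 * h \<le> x' \<and>
     int q dvd int x' - int x - int l * int p \<and> int q dvd int y' - int y - int l * (int p)\<^sup>2"

fun adj :: "nat \<Rightarrow> vert \<Rightarrow> vert \<Rightarrow> bool" where
  "adj l (Line p c) (Point x y) \<longleftrightarrow> on p c x y"
| "adj l (Point x y) (Line p c) \<longleftrightarrow> on p c x y"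
| "adj l (Point x y) (Point x' y') \<longleftrightarrow> (\<exists>p. step l p x y x' y' \<or> step l p x' y' x y)"
| "adj l (Line _ _) (Line _ _) \<longleftrightarrow> False"

lemma dvd_add_diff4:
  "d dvd a \<Longrightarrow> d dvd b \<Longrightarrow> d dvd c \<Longrightarrow> d dvd e \<Longrightarrow> d dvd a - b + c - (e :: int)"
  by (simp add: dvd_add dvd_diff)

lemma step_dx: "step l p x y x' y' \<Longrightarrow> int q dvd int x' - int x - int l * int p"
  and step_dy: "step l p x y x' y' \<Longrightarrow> int q dvd int y' - int y - int l * (int p)\<^sup>2"
  and step_slope: "step l p x y x' y' \<Longrightarrow> p \<in> slopes"
  by (auto simp: step_def)

lemma step_orient:
  assumes "step l p x y a b \<or> step l p a b x y"
  shows "x < 2 * h \<Longrightarrow> step l p x y a b \<and> \<not> a < 2 * h"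
    and "\<not> x < 2 * h \<Longrightarrow> step l p a b x y \<and> a < 2 * h"
  using assms by (auto simp: step_def)

lemma q_dvd_small:
  assumes "int q dvd z" "\<bar>z\<bar> < int q"
  shows "z = 0"
  using dvd_imp_le_int[of z "int q"] assms by fastforce

lemma q_dvd_diff:
  assumes "int q dvd int a - int b" "a < q" "b < q"
  shows "a = b"
proof -
  have "\<bar>int a - int b\<bar> < int q" using assms(2,3) by linarith
  from q_dvd_small[OF assms(1) this] show ?thesis by simp
qed

lemma q_prime: "int q dvd a * b \<longleftrightarrow> int q dvd a \<or> int q dvd b"
  using q by (simp add: prime_dvd_mult_iff)

lemma slopes_less: "p \<in> slopes \<Longrightarrow> p < q" and slopes_pos: "p \<in> slopes \<Longrightarrow> 0 < p"
  using h by (auto simp: slopes_def)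

lemma lines_meet_once:
  assumes "on p c x y" "on p c x' y'" "on p' c' x y" "on p' c' x' y'"
    and "p < q" "p' < q" "c < q" "c' < q" "x < q" "x' < q" "y < q" "y' < q"
  shows "p = p' \<and> c = c' \<or> x = x' \<and> y = y'"
proof -
  note on = assms(1-4)[unfolded on_def]
  have "int q dvd (int y - int p * int x - int c) - (int y' - int p * int x' - int c)
     + (int y' - int p' * int x' - int c') - (int y - int p' * int x - int c')"
    by (rule dvd_add_diff4[OF on(1,2,4,3)])
  also have "\<dots> = (int p' - int p) * (int x - int x')" by (simp add: algebra_simps)
  finally have "int q dvd int p' - int p \<or> int q dvd int x - int x'"
    by (simp only: q_prime)
  then have "p' = p \<or> x = x'"
    using q_dvd_diff[of p' p] q_dvd_diff[of x x'] assms(5-) by blast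
  then show ?thesis
  proof
    assume 1: "p' = p"
    have "int q dvd (int y - int p' * int x - int c') - (int y - int p * int x - int c)"
      by (rule dvd_diff[OF on(3,1)])
    then have "int q dvd int c - int c'" using 1 by simp
    then show ?thesis using 1 q_dvd_diff[of c c'] assms(5-) by blast
  next
    assume 2: "x = x'"
    have "int q dvd (int y - int p * int x - int c) - (int y' - int p * int x' - int c)"
      by (rule dvd_diff[OF on(1,2)])
    then have "int q dvd int y - int y'" using 2 by simp
    then show ?thesis using 2 q_dvd_diff[of y y'] assms(5-) by blast
  qed
qed

text \<open>The vectors \<open>(l p, l p\<^sup>2)\<close> form a Sidon set: the differences of \<open>p\<close> and of \<open>p\<^sup>2\<close> together determine
  both slopes. All congruences between slopes that occur are equalities because the slopes are small.\<close>
lemma no_cycle_of_steps: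
  assumes l: "\<not> int q dvd int l"
    and s: "step l p1 x1 y1 a b" "step l p2 x2 y2 a b" "step l p3 x1 y1 a' b'" "step l p4 x2 y2 a' b'"
    and small: "x1 < q" "x2 < q" "y1 < q" "y2 < q" "a < q" "b < q" "a' < q" "b' < q"
  shows "x1 = x2 \<and> y1 = y2 \<or> a = a' \<and> b = b'"
proof -
  note sl = s[THEN step_slope]
  note dx = s[THEN step_dx] and dy = s[THEN step_dy]
  have bd: "int p \<ge> int h + 1 \<and> int p \<le> 2 * int h" if "p \<in> slopes" for p
    using that by (auto simp: slopes_def)
  note bounds = bd[OF sl(1)] bd[OF sl(2)] bd[OF sl(3)] bd[OF sl(4)]
  have h': "4 * int h < int q" using h by linarith
  have "int q dvd (int a - int x2 - int l * int p2) - (int a - int x1 - int l * int p1)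
      + (int a' - int x1 - int l * int p3) - (int a' - int x2 - int l * int p4)"
    by (rule dvd_add_diff4[OF dx(2,1,3,4)])
  also have "\<dots> = int l * (int p1 - int p2 - int p3 + int p4)" by (simp add: algebra_simps)
  finally have "int q dvd int p1 - int p2 - int p3 + int p4" using l by (simp only: q_prime simp_thms)
  then have "int p1 - int p2 - int p3 + int p4 = 0"
    by (rule q_dvd_small) (use bounds h' in linarith)
  then have diff: "int p1 - int p2 = int p3 - int p4" by simp
  have "int q dvd (int b - int y2 - int l * (int p2)\<^sup>2) - (int b - int y1 - int l * (int p1)\<^sup>2)
      + (int b' - int y1 - int l * (int p3)\<^sup>2) - (int b' - int y2 - int l * (int p4)\<^sup>2)"
    by (rule dvd_add_diff4[OF dy(2,1,3,4)])
  also have "\<dots> = int l * ((int p1)\<^sup>2 - (int p2)\<^sup>2 - ((int p3)\<^sup>2 - (int p4)\<^sup>2))" by (simp add: algebra_simps)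
  also have "(int p1)\<^sup>2 - (int p2)\<^sup>2 - ((int p3)\<^sup>2 - (int p4)\<^sup>2)
      = (int p1 - int p2) * (int p1 + int p2) - (int p3 - int p4) * (int p3 + int p4)"
    by (simp add: power2_eq_square algebra_simps)
  also have "\<dots> = (int p1 - int p2) * (int p1 + int p2 - int p3 - int p4)"
    unfolding diff by (simp add: algebra_simps)
  finally have "int q dvd int p1 - int p2 \<or> int q dvd int p1 + int p2 - int p3 - int p4"
    using l by (simp only: q_prime simp_thms)
  then consider "int q dvd int p1 - int p2" | "int q dvd int p1 + int p2 - int p3 - int p4" by blast
  then show ?thesis
  proof cases
    case 1
    then have "p1 = p2" using q_dvd_diff[of p1 p2] slopes_less sl by blast
    have "int q dvd (int a - int x2 - int l * int p2) - (int a - int x1 - int l * int p1)"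
      by (rule dvd_diff[OF dx(2,1)])
    then have "int q dvd int x1 - int x2" using \<open>p1 = p2\<close> by simp
    moreover have "int q dvd (int b - int y2 - int l * (int p2)\<^sup>2) - (int b - int y1 - int l * (int p1)\<^sup>2)"
      by (rule dvd_diff[OF dy(2,1)])
    then have "int q dvd int y1 - int y2" using \<open>p1 = p2\<close> by simp
    ultimately show ?thesis using q_dvd_diff[of x1 x2] q_dvd_diff[of y1 y2] small by blast
  next
    case 2
    then have "int p1 + int p2 - int p3 - int p4 = 0"
      by (rule q_dvd_small) (use bounds h' in linarith)
    then have "p1 = p3" using diff by linarith
    have "int q dvd (int a - int x1 - int l * int p1) - (int a' - int x1 - int l * int p3)"
      by (rule dvd_diff[OF dx(1,3)])
    then have "int q dvd int a - int a'" using \<open>p1 = p3\<close> by simp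
    moreover have "int q dvd (int b - int y1 - int l * (int p1)\<^sup>2) - (int b' - int y1 - int l * (int p3)\<^sup>2)"
      by (rule dvd_diff[OF dy(1,3)])
    then have "int q dvd int b - int b'" using \<open>p1 = p3\<close> by simp
    ultimately show ?thesis using q_dvd_diff[of a a'] q_dvd_diff[of b b'] small by blast
  qed
qed

text \<open>Two steps along slopes \<open>p1\<close> and \<open>p2\<close>, one forwards and one backwards, lead to a point on the line
  of slope \<open>p1 + p2\<close> through the starting point, and this is not an admissible slope; so the two steps cancel. The sign \<open>s\<close> records
  which of the two steps is taken forwards.\<close>
lemma line_misses_two_step_path:
  assumes l: "\<not> int q dvd int l" and p: "p \<in> slopes" "p1 \<in> slopes" "p2 \<in> slopes"
    and on: "on p c x y" "on p c x' y'"
    and dx: "int q dvd (int x' - int x) - s * int l * (int p1 - int p2)"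
    and dy: "int q dvd (int y' - int y) - s * int l * ((int p1)\<^sup>2 - (int p2)\<^sup>2)"
    and s: "s = 1 \<or> s = -1"
    and small: "x < q" "x' < q" "y < q" "y' < q"
  shows "x = x' \<and> y = y'"
proof -
  have bd: "int p \<ge> int h + 1 \<and> int p \<le> 2 * int h" if "p \<in> slopes" for p
    using that by (auto simp: slopes_def)
  note bounds = bd[OF p(1)] bd[OF p(2)] bd[OF p(3)]
  have h': "4 * int h < int q" using h by linarith
  have "int q dvd (int y' - int p * int x' - int c) - (int y - int p * int x - int c)
     - ((int y' - int y) - s * int l * ((int p1)\<^sup>2 - (int p2)\<^sup>2))
     + int p * ((int x' - int x) - s * int l * (int p1 - int p2))"
    by (rule dvd_add[OF dvd_diff[OF dvd_diff[OF on(2,1)[unfolded on_def]] dy] dvd_mult[OF dx]])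
  also have "\<dots> = (s * int l) * ((int p1 - int p2) * (int p1 + int p2 - int p))"
    by (simp add: power2_eq_square algebra_simps)
  finally have "int q dvd (s * int l) * ((int p1 - int p2) * (int p1 + int p2 - int p))" .
  moreover have "\<not> int q dvd s * int l" using l s by auto
  ultimately have "int q dvd int p1 - int p2 \<or> int q dvd int p1 + int p2 - int p"
    by (metis q_prime)
  then consider "int q dvd int p1 - int p2" | "int q dvd int p1 + int p2 - int p" by blast
  then show ?thesis
  proof cases
    case 1
    then have "p1 = p2" using q_dvd_diff[of p1 p2] slopes_less p by blast
    then show ?thesis using dx dy small q_dvd_diff[of x' x] q_dvd_diff[of y' y] by auto
  next
    case 2
    then have "int p1 + int p2 - int p = 0"
      by (rule q_dvd_small) (use bounds h' in linarith)
    then show ?thesis using bounds by linarith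
  qed
qed

lemma adj_sym: "adj l u v \<longleftrightarrow> adj l v u"
  by (cases u; cases v) auto

text \<open>The opposite vertices \<open>u\<close> and \<open>u'\<close> of a potential \<open>C\<^sub>4\<close> are of the same kind. For two
  lines the common neighbours are points. For two points there are three cases: two
  common lines, two common points, or one of each.\<close>
lemma codegree_le_1:
  assumes l: "\<not> int q dvd int l" and val: "valid u" "valid u'" "valid w" "valid w'"
    and adj: "adj l u w" "adj l u w'" "adj l u' w" "adj l u' w'"
    and kind: "(\<exists>p c p' c'. u = Line p c \<and> u' = Line p' c') \<or> (\<exists>x y x' y'. u = Point x y \<and> u' = Point x' y')"
  shows "u = u' \<or> w = w'"
proof -
  have small: "a < q" if "a < 4 * h" for a using that h by simp
  have mixed: "u = u'" if uu: "u = Point x y" "u' = Point x' y'" and a: "adj l u (Line p c)" "adj l u' (Line p c)"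
    and b: "adj l u (Point a b)" "adj l u' (Point a b)" and v: "valid (Line p c)" for x y x' y' p c a b
  proof -
    have on: "on p c x y" "on p c x' y'" and p: "p \<in> slopes" using that by auto
    obtain p1 p2 where "step l p1 x y a b \<or> step l p1 a b x y" "step l p2 x' y' a b \<or> step l p2 a b x' y'"
      using b uu by auto
    then have or1: "step l p1 a b x y \<or> step l p1 x y a b" and or2: "step l p2 a b x' y' \<or> step l p2 x' y' a b"
      by auto
    consider "step l p1 x y a b" "step l p2 x' y' a b" | "step l p1 a b x y" "step l p2 a b x' y'"
      using step_orient[OF or1] step_orient[OF or2] by blast
    then show ?thesis
    proof cases
      case 1
      have "int q dvd int x' - int x - 1 * int l * (int p1 - int p2)"
        using dvd_diff[OF step_dx[OF 1(1)] step_dx[OF 1(2)]] by (simp add: algebra_simps)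
      moreover have "int q dvd int y' - int y - 1 * int l * ((int p1)\<^sup>2 - (int p2)\<^sup>2)"
        using dvd_diff[OF step_dy[OF 1(1)] step_dy[OF 1(2)]] by (simp add: algebra_simps)
      ultimately have "x = x' \<and> y = y'"
        by (rule line_misses_two_step_path[OF l p step_slope[OF 1(1)] step_slope[OF 1(2)] on])
          (use val uu small in auto)
      then show ?thesis using uu by simp
    next
      case 2
      have "int q dvd int x' - int x - (-1) * int l * (int p1 - int p2)"
        using dvd_diff[OF step_dx[OF 2(2)] step_dx[OF 2(1)]] by (simp add: algebra_simps)
      moreover have "int q dvd int y' - int y - (-1) * int l * ((int p1)\<^sup>2 - (int p2)\<^sup>2)"
        using dvd_diff[OF step_dy[OF 2(2)] step_dy[OF 2(1)]] by (simp add: algebra_simps)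
      ultimately have "x = x' \<and> y = y'"
        by (rule line_misses_two_step_path[OF l p step_slope[OF 2(1)] step_slope[OF 2(2)] on])
          (use val uu small in auto)
      then show ?thesis using uu by simp
    qed
  qed
  from kind show ?thesis
  proof (elim disjE exE conjE)
    fix p c p' c' assume uu: "u = Line p c" "u' = Line p' c'"
    then obtain x y x' y' where ww: "w = Point x y" "w' = Point x' y'"
      using adj by (cases w; cases w') auto
    show ?thesis
      using lines_meet_once[of p c x y x' y' p' c'] adj val uu ww small slopes_less by auto
  next
    fix x y x' y' assume uu: "u = Point x y" "u' = Point x' y'"
    show ?thesis
    proof (cases w; cases w')
      fix p c p' c' assume ww: "w = Line p c" "w' = Line p' c'"
      show ?thesis
        using lines_meet_once[of p c x y x' y' p' c'] adj val uu ww small slopes_less by auto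
    next
      fix p c a b assume ww: "w = Line p c" "w' = Point a b"
      then show ?thesis using mixed[OF uu, of p c a b] adj val by auto
    next
      fix p c a b assume ww: "w = Point a b" "w' = Line p c"
      then show ?thesis using mixed[OF uu, of p c a b] adj val by auto
    next
      fix a b a' b' assume ww: "w = Point a b" "w' = Point a' b'"
      obtain p1 p2 p3 p4 where
        or: "step l p1 a b x y \<or> step l p1 x y a b" "step l p2 a b x' y' \<or> step l p2 x' y' a b"
        "step l p3 x y a' b' \<or> step l p3 a' b' x y" "step l p4 a' b' x' y' \<or> step l p4 x' y' a' b'"
        using adj unfolding uu ww adj.simps by blast
      consider "step l p1 x y a b" "step l p2 x' y' a b" "step l p3 x y a' b'" "step l p4 x' y' a' b'"
        | "step l p1 a b x y" "step l p2 a b x' y'" "step l p3 a' b' x y" "step l p4 a' b' x' y'"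
        using step_orient[OF or(1)] step_orient[OF or(2)] step_orient[OF or(3)] step_orient[OF or(4)]
        by blast
      then show ?thesis
      proof cases
        case 1
        then show ?thesis using no_cycle_of_steps[OF l 1] val uu ww small by auto
      next
        case 2
        then show ?thesis using no_cycle_of_steps[OF l 2(1,3,2,4)] val uu ww small by auto
      qed
    qed
  qed
qed

lemma digits_inj:
  assumes "a * q + b = a' * q + b'" "b < q" "b' < q"
  shows "a = a' \<and> b = b'"
proof -
  have "(a * q + b) div q = a" "(a' * q + b') div q = a'" using assms(2,3) by auto
  then have "a = a'" using assms(1) by simp
  then show ?thesis using assms(1) by simp
qed

lemma digits_less:
  assumes "a < q" "b < q"
  shows "a * q + b < q\<^sup>2"
proof -
  have "a * q + b < (a + 1) * q" using assms by simp
  also have "\<dots> \<le> q * q" using assms by (intro mult_right_mono) auto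
  finally show ?thesis by (simp add: power2_eq_square)
qed

lemma enc_bounds:
  assumes "valid v"
  shows "enc v < n" and "enc v < q\<^sup>2 \<longleftrightarrow> (\<exists>p c. v = Line p c)"
proof -
  have "enc v < n \<and> (enc v < q\<^sup>2 \<longleftrightarrow> (\<exists>p c. v = Line p c))"
  proof (cases v)
    case (Line p c)
    then have "p * q + c < q\<^sup>2" using assms slopes_less by (intro digits_less) auto
    then show ?thesis using Line n by simp
  next
    case (Point x y)
    then have "x * q + y < q\<^sup>2" using assms h by (intro digits_less) auto
    then show ?thesis using Point n by simp
  qed
  then show "enc v < n" and "enc v < q\<^sup>2 \<longleftrightarrow> (\<exists>p c. v = Line p c)" by blast+
qed

lemma enc_inject:
  assumes "valid u" "valid v" "enc u = enc v"
  shows "u = v"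
proof (cases "enc u < q\<^sup>2")
  case True
  then obtain p c p' c' where "u = Line p c" "v = Line p' c'"
    using enc_bounds(2) assms by metis
  then show ?thesis using assms digits_inj[of p c p' c'] by simp
next
  case False
  then have "\<not> (\<exists>p c. u = Line p c)" "\<not> (\<exists>p c. v = Line p c)"
    using enc_bounds(2) assms by metis+
  then obtain x y x' y' where "u = Point x y" "v = Point x' y'" by (meson vert.exhaust)
  then show ?thesis using assms digits_inj[of x y x' y'] by simp
qed

definition graph :: "nat \<Rightarrow> nat set set" where
  "graph l = {{enc u, enc v} | u v. valid u \<and> valid v \<and> adj l u v}"

text \<open>In a \<open>C\<^sub>4\<close> at least one of the two pairs of opposite vertices consists of vertices of the same kind,
  since a line is adjacent to points only.\<close>
lemma graph_free:
  assumes l: "\<not> int q dvd int l"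
  shows "free_of (cycle_graph 4) ({..<n}, graph l)"
proof (rule ccontr)
  assume "\<not> ?thesis"
  moreover have "3 \<le> (4 :: nat)" by simp
  ultimately obtain c where inj: "inj_on c {..<4::nat}"
    and edge: "\<And>i. i < 4 \<Longrightarrow> {c i, c (Suc i mod 4)} \<in> graph l"
    using free_of_cycle_graph_iff[of 4 "{..<n}" "graph l"] by metis
  have "\<exists>v. valid v \<and> c i = enc v" if i: "i < 4" for i
  proof -
    obtain u w where "valid u" "valid w" "{c i, c (Suc i mod 4)} = {enc u, enc w}"
      using edge[OF i] unfolding graph_def by blast
    then show ?thesis unfolding doubleton_eq_iff by blast
  qed
  then obtain v where v: "\<And>i. i < 4 \<Longrightarrow> valid (v i)" "\<And>i. i < 4 \<Longrightarrow> c i = enc (v i)" by metis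
  have vadj: "adj l (v i) (v (Suc i mod 4))" if i: "i < 4" for i
  proof -
    obtain u w where uw: "valid u" "valid w" "adj l u w" "{c i, c (Suc i mod 4)} = {enc u, enc w}"
      using edge[OF i] unfolding graph_def by blast
    have i': "Suc i mod 4 < 4" by simp
    have "{enc (v i), enc (v (Suc i mod 4))} = {enc u, enc w}" using uw(4) v(2)[OF i] v(2)[OF i'] by simp
    then have "v i = u \<and> v (Suc i mod 4) = w \<or> v i = w \<and> v (Suc i mod 4) = u"
      using enc_inject[OF v(1)[OF i] uw(1)] enc_inject[OF v(1)[OF i] uw(2)]
        enc_inject[OF v(1)[OF i'] uw(1)] enc_inject[OF v(1)[OF i'] uw(2)]
      unfolding doubleton_eq_iff by blast
    then show ?thesis using uw(3) adj_sym[of l u w] by blast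
  qed
  have "c 0 \<noteq> c 2" "c 1 \<noteq> c 3" using inj_onD[OF inj, of 0 2] inj_onD[OF inj, of 1 3] by auto
  then have ne: "v 0 \<noteq> v 2" "v 1 \<noteq> v 3" using v(2)[of 0] v(2)[of 1] v(2)[of 2] v(2)[of 3] by auto
  have m: "Suc 0 mod 4 = (1 :: nat)" "Suc 1 mod 4 = (2 :: nat)" "Suc 2 mod 4 = (3 :: nat)"
    "Suc 3 mod 4 = (0 :: nat)" by simp_all
  have "adj l (v 0) (v 1)" "adj l (v 1) (v 2)" "adj l (v 2) (v 3)" "adj l (v 3) (v 0)"
    using vadj[of 0, unfolded m] vadj[of 1, unfolded m] vadj[of 2, unfolded m] vadj[of 3, unfolded m]
    by simp_all
  then have a: "adj l (v 0) (v 1)" "adj l (v 2) (v 1)" "adj l (v 2) (v 3)" "adj l (v 0) (v 3)"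
    and a': "adj l (v 1) (v 0)" "adj l (v 1) (v 2)" "adj l (v 3) (v 0)" "adj l (v 3) (v 2)"
    using adj_sym by blast+
  have val: "valid (v 0)" "valid (v 1)" "valid (v 2)" "valid (v 3)" using v by auto
  show False
  proof (cases "(\<exists>p c p' c'. v 0 = Line p c \<and> v 2 = Line p' c') \<or> (\<exists>x y x' y'. v 0 = Point x y \<and> v 2 = Point x' y')")
    case True
    then show False using codegree_le_1[OF l val(1,3,2,4) a(1,4,2,3) True] ne by blast
  next
    case False
    have nbr: "\<exists>x y. w = Point x y" if "adj l (Line p c) w" for p c w
      using that by (cases w) auto
    have "\<exists>x y x' y'. v 1 = Point x y \<and> v 3 = Point x' y'"
    proof (cases "\<exists>p c. v 0 = Line p c")
      case True
      then show ?thesis using nbr a(1,4) by metis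
    next
      case no: False
      then obtain x y where "v 0 = Point x y" by (meson vert.exhaust)
      then obtain p c where "v 2 = Line p c" using False by (meson vert.exhaust)
      then show ?thesis using nbr a(2,3) by metis
    qed
    then show False
      using codegree_le_1[OF l val(2,4,1,3) a'(1,2,3,4)] ne by blast
  qed
qed

end

context plane
begin

definition height :: "nat \<Rightarrow> nat \<Rightarrow> nat \<Rightarrow> nat" where
  "height p c x = (p * x + c) mod q"

lemma q_pos: "0 < q" using h by simp

lemma height_less: "height p c x < q"
  using q_pos by (simp add: height_def)

lemma on_height: "on p c x (height p c x)"
proof -
  have "int (height p c x) = (int p * int x + int c) mod int q" by (simp add: height_def zmod_int)
  then have "int q dvd int (height p c x) - (int p * int x + int c)"
    by (metis dvd_minus_mod dvd_diff_commute)
  then show ?thesis by (simp add: on_def algebra_simps)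
qed

text \<open>Every pair of points on a line, one from each half, is joined in some target: the parameter is the
  difference of the abscissae divided by the slope.\<close>
lemma scaled_slope_exists:
  assumes p: "p \<in> slopes" and d: "\<not> int q dvd d"
  shows "\<exists>l\<in>{1..<q}. int q dvd d - int l * int p"
proof -
  have "\<not> int q dvd int p" using slopes_pos[OF p] slopes_less[OF p] by (auto dest: dvd_imp_le)
  then have "coprime (int q) (int p)" using q by (intro prime_imp_coprime) auto
  then obtain u v where "u * int q + v * int p = 1"
    using bezout_int[of "int q" "int p"] by (auto simp: coprime_iff_gcd_eq_1)
  then have "d - (d * v) * int p = d * u * int q" by (metis (no_types) mult.assoc mult.commute mult.right_neutral add_diff_cancel_right' distrib_left)
  then have e: "int q dvd d - (d * v) * int p" by simp
  define l where "l = nat ((d * v) mod int q)"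
  have l: "int l = (d * v) mod int q" using q_pos by (simp add: l_def)
  have "int q dvd (d - (d * v) * int p) + (d * v - (d * v) mod int q) * int p"
    using e by (intro dvd_add dvd_mult2 dvd_minus_mod)
  also have "\<dots> = d - int l * int p" by (simp add: l algebra_simps)
  finally have dl: "int q dvd d - int l * int p" .
  moreover have "l < q" using l q_pos by (metis of_nat_0_less_iff of_nat_less_iff pos_mod_bound)
  moreover have "l \<noteq> 0" using dl d by (cases "l = 0") auto
  ultimately show ?thesis by auto
qed

definition chord :: "(nat \<times> nat) \<Rightarrow> nat \<Rightarrow> nat \<Rightarrow> nat set" where
  "chord = (\<lambda>(p, c) x x'. {enc (Point x (height p c x)), enc (Point x' (height p c x'))})"

definition flag :: "(nat \<times> nat) \<Rightarrow> nat \<Rightarrow> nat set" where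
  "flag = (\<lambda>(p, c) x. {enc (Line p c), enc (Point x (height p c x))})"

definition lines :: "(nat \<times> nat) set" where "lines = slopes \<times> {..<q}"

lemma flag_in_graph:
  assumes "a \<in> lines" "x < 4 * h"
  shows "flag a x \<in> graph l"
proof -
  obtain p c where a: "a = (p, c)" by fastforce
  have "valid (Line p c)" "valid (Point x (height p c x))" "adj l (Line p c) (Point x (height p c x))"
    using assms height_less on_height by (auto simp: a lines_def)
  then show ?thesis unfolding graph_def flag_def a prod.case by blast
qed

lemma chord_in_graph:
  assumes "(p, c) \<in> lines" "x < 2 * h" "2 * h \<le> x'" "x' < 4 * h"
    and l: "int q dvd (int x' - int x) - int l * int p"
  shows "chord (p, c) x x' \<in> graph l"
proof -
  let ?y = "height p c x" and ?y' = "height p c x'"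
  have "int q dvd (int ?y' - int p * int x' - int c) - (int ?y - int p * int x - int c)
     + int p * ((int x' - int x) - int l * int p)"
    using on_height[of p c x] on_height[of p c x'] l unfolding on_def
    by (intro dvd_add[OF dvd_diff dvd_mult])
  also have "\<dots> = int ?y' - int ?y - int l * (int p)\<^sup>2" by (simp add: algebra_simps power2_eq_square)
  finally have "step l p x ?y x' ?y'" using assms by (auto simp: step_def lines_def)
  then have "adj l (Point x ?y) (Point x' ?y')" by auto
  moreover have "valid (Point x ?y)" "valid (Point x' ?y')" using assms height_less by auto
  ultimately show ?thesis unfolding graph_def chord_def prod.case by blast
qed

lemma graph_complete: "graph l \<subseteq> edges (complete_graph n)"
proof
  fix e assume "e \<in> graph l"
  then obtain u v where uv: "e = {enc u, enc v}" "valid u" "valid v" "adj l u v" by (auto simp: graph_def)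
  have "u \<noteq> v" using uv(4) by (cases u) (auto simp: step_def)
  then have "enc u \<noteq> enc v" using enc_inject uv by blast
  then show "e \<in> edges (complete_graph n)"
    using uv enc_bounds(1) by (auto simp: complete_graph_def)
qed

lemma flag_inject:
  assumes "a \<in> lines" "a' \<in> lines" "x < 4 * h" "x' < 4 * h" "flag a x = flag a' x'"
  shows "a = a' \<and> x = x'"
proof -
  obtain p c p' c' where a: "a = (p, c)" "a' = (p', c')" by fastforce
  have v: "valid (Line p c)" "valid (Line p' c')" "valid (Point x (height p c x))"
    "valid (Point x' (height p' c' x'))" using assms height_less by (auto simp: a lines_def)
  have "enc (Line p c) \<noteq> enc (Point x' (height p' c' x'))" using enc_inject v by blast
  then have "enc (Line p c) = enc (Line p' c')"
    "enc (Point x (height p c x)) = enc (Point x' (height p' c' x'))"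
    using assms(5) by (auto simp only: a flag_def prod.case doubleton_eq_iff)
  then show ?thesis using enc_inject v a by blast
qed

lemma chord_inject:
  assumes "a \<in> lines" "a' \<in> lines" "x1 < 2 * h" "x1' < 2 * h" "2 * h \<le> x2" "2 * h \<le> x2'"
    "x2 < 4 * h" "x2' < 4 * h" "chord a x1 x2 = chord a' x1' x2'"
  shows "a = a' \<and> x1 = x1' \<and> x2 = x2'"
proof -
  obtain p c p' c' where a: "a = (p, c)" "a' = (p', c')" by fastforce
  have v: "valid (Point x1 (height p c x1))" "valid (Point x2 (height p c x2))"
    "valid (Point x1' (height p' c' x1'))" "valid (Point x2' (height p' c' x2'))"
    using assms height_less by auto
  have "enc (Point x1 (height p c x1)) \<noteq> enc (Point x2' (height p' c' x2'))"
    using enc_inject[OF v(1,4)] assms by auto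
  then have "enc (Point x1 (height p c x1)) = enc (Point x1' (height p' c' x1'))"
    "enc (Point x2 (height p c x2)) = enc (Point x2' (height p' c' x2'))"
    using assms(9) by (auto simp only: a chord_def prod.case doubleton_eq_iff)
  then have eq: "x1 = x1'" "height p c x1 = height p' c' x1'" "x2 = x2'" "height p c x2 = height p' c' x2'"
    using enc_inject[OF v(1,3)] enc_inject[OF v(2,4)] by auto
  have "p = p' \<and> c = c' \<or> x1 = x2 \<and> height p c x1 = height p c x2"
  proof (rule lines_meet_once[OF on_height on_height])
    show "on p' c' x1 (height p c x1)" "on p' c' x2 (height p c x2)"
      using on_height[of p' c'] eq by metis+
  qed (use assms height_less slopes_less h in \<open>auto simp: a lines_def\<close>)
  then show ?thesis using eq assms a by auto
qed

text \<open>There are \<open>hq\<close> lines. In the first stage Constructor claims, on every line, one of every two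
  consecutive points, that is \<open>h\<close> points in either half; this gives \<open>h\<^sup>3 q\<close> chords which would close a triangle.
  Blocker has made at most \<open>2h\<^sup>2 q\<close> moves and each spoils at most one chord, so one of the \<open>q - 1\<close>
  parameters retains at least \<open>h\<^sup>2 (h - 2)\<close> chords. In the second stage she claims half of them.\<close>
lemma cube_le_g_num:
  assumes h4: "4 \<le> h"
  shows "h ^ 3 \<le> 8 * g_num n (complete_graph 3) (cycle_graph 4)"
proof -
  let ?F = "cycle_graph 4"
  let ?K = "edges (complete_graph n)"
  define t where "t = h\<^sup>2 * (h - 2) div 2"
  define pair where "pair = (\<lambda>((a, i), s). flag a (2 * i + (if s then 1 else 0 :: nat)))"
  define J where "J = lines \<times> {..<2 * h}"
  have nd1: "\<not> int q dvd int l" if "l \<in> {1..<q}" for l using that by (auto dest: dvd_imp_le)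
  have l1: "\<not> int q dvd int 1" using nd1[of 1] h h4 by simp
  have finL: "finite lines" by (simp add: lines_def slopes_def)
  have cardL: "card lines = h * q" by (simp add: lines_def slopes_def card_cartesian_product)
  have "t \<le> game_value n (complete_graph 3) ?F Constructor {} {}"
  proof (rule pairing[of J pair])
    show "finite J" using finL by (simp add: J_def)
    show "inj_on pair (J \<times> UNIV)"
    proof (rule inj_onI)
      fix x y assume "x \<in> J \<times> UNIV" "y \<in> J \<times> UNIV" and eq: "pair x = pair y"
      then obtain a i s a' i' s' where xy: "x = ((a, i), s)" "y = ((a', i'), s')"
        "a \<in> lines" "a' \<in> lines" "i < 2 * h" "i' < 2 * h" by (auto simp: J_def)
      let ?x = "2 * i + (if s then 1 else 0)" and ?x' = "2 * i' + (if s' then 1 else 0)"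
      have "?x < 4 * h" "?x' < 4 * h" using xy by auto
      then have "a = a' \<and> ?x = ?x'" using flag_inject[OF xy(3,4)] eq by (simp add: pair_def xy)
      then show "x = y" using xy by (auto split: if_splits; presburger)
    qed
    have sub: "pair ` (J \<times> UNIV) \<subseteq> graph l" for l
      by (auto simp: J_def pair_def intro!: flag_in_graph)
    show "pair ` (J \<times> UNIV) \<subseteq> ?K - ({} \<union> {})" using sub graph_complete by blast
    show "free_of ?F ({..<n}, {} \<union> pair ` (J \<times> UNIV))"
      by (rule free_of_mono[OF graph_free[OF l1]]) (use sub in auto)
    show "finite {}" by simp
    fix \<sigma> and B1 :: "nat set set" assume B1: "finite B1" "card B1 \<le> card ({} :: nat set set) + card J"
    define C1 where "C1 = (\<lambda>x. pair (x, \<sigma> x)) ` J"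
    have C1_graph: "C1 \<subseteq> graph l" for l unfolding C1_def using sub by blast
    \<comment> \<open>The abscissa that Constructor received from the \<open>i\<close>-th pair of the line \<open>a\<close>. It lies in the left
       half for \<open>i < h\<close> and in the right half otherwise.\<close>
    define X where "X = (\<lambda>a i. 2 * i + (if \<sigma> (a, i) then 1 else 0 :: nat))"
    have X_div: "X a i div 2 = i" for a i by (simp add: X_def)
    have X1: "X a i < 2 * h" if "i < h" for a i using that by (auto simp: X_def)
    have X2: "2 * h \<le> X a i" "X a i < 4 * h" if "h \<le> i" "i < 2 * h" for a i using that by (auto simp: X_def)
    have C1_flag: "flag a (X a i) \<in> C1" if "a \<in> lines" "i < 2 * h" for a i
      using that by (auto simp: C1_def J_def pair_def X_def image_iff intro!: bexI[of _ "(a, i)"])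
    define \<phi> where "\<phi> = (\<lambda>(a, i, i'). chord a (X a i) (X a i'))"
    define T where "T = lines \<times> {..<h} \<times> {h..<2 * h}"
    have inj_\<phi>: "inj_on \<phi> T"
    proof (rule inj_onI)
      fix s s' assume s: "s \<in> T" "s' \<in> T" "\<phi> s = \<phi> s'"
      obtain a i j a' i' j' where ss: "s = (a, i, j)" "s' = (a', i', j')" by (metis prod_cases3)
      have "a = a' \<and> X a i = X a' i' \<and> X a j = X a' j'"
        using s X1 X2 by (intro chord_inject) (auto simp: ss T_def \<phi>_def)
      then show "s = s'" using X_div ss by metis
    qed
    define U where "U = {s \<in> T. \<phi> s \<notin> B1}"
    have finT: "finite T" using finL by (simp add: T_def)
    have cardT: "card T = h * q * h\<^sup>2"
      by (simp add: T_def card_cartesian_product cardL power2_eq_square)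
    have "card (T - U) \<le> card B1"
      by (rule card_inj_on_le[of \<phi>]) (use inj_\<phi> B1(1) in \<open>auto simp: U_def intro: inj_on_subset\<close>)
    moreover have "card B1 \<le> 2 * h * (h * q)" using B1(2) by (simp add: J_def card_cartesian_product cardL mult.commute)
    moreover have "card (T - U) = card T - card U"
      by (rule card_Diff_subset) (use finT in \<open>auto simp: U_def\<close>)
    ultimately have "h * q * h\<^sup>2 \<le> card U + 2 * h * (h * q)" using cardT by linarith
    then have cardU: "q * (h\<^sup>2 * (h - 2)) \<le> card U"
      using h4 by (simp add: power2_eq_square algebra_simps diff_mult_distrib2)
    have "\<exists>l\<in>{1..<q}. int q dvd (int (X a i') - int (X a i)) - int l * int (fst a)"
      if "(a, i, i') \<in> T" for a i i'
    proof (rule scaled_slope_exists)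
      show "fst a \<in> slopes" using that by (auto simp: T_def lines_def)
      have "X a i < 2 * h" "2 * h \<le> X a i'" "X a i' < 4 * h" using that X1 X2 by (auto simp: T_def)
      then show "\<not> int q dvd int (X a i') - int (X a i)"
        using q_dvd_diff[of "X a i'" "X a i"] h by auto
    qed
    then have "\<forall>s\<in>T. \<exists>l. l \<in> {1..<q} \<and> (case s of (a, i, i') \<Rightarrow>
        int q dvd (int (X a i') - int (X a i)) - int l * int (fst a))" by fastforce
    then obtain lam where lam: "\<And>s. s \<in> T \<Longrightarrow> lam s \<in> {1..<q}"
      "\<And>a i i'. (a, i, i') \<in> T \<Longrightarrow> int q dvd (int (X a i') - int (X a i)) - int (lam (a, i, i')) * int (fst a)"
      by (fastforce dest!: bchoice)
    have "\<exists>l\<in>{1..<q}. card U \<le> card {1..<q} * card {s \<in> U. lam s = l}"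
    proof (rule large_fibre_exists)
      show "finite U" using finT by (simp add: U_def)
      show "{1..<q} \<noteq> {}" using h h4 by auto
      show "lam ` U \<subseteq> {1..<q}" using lam(1) by (auto simp: U_def)
    qed simp
    then obtain l where l: "l \<in> {1..<q}" and le: "card U \<le> card {1..<q} * card {s \<in> U. lam s = l}" by blast
    define W where "W = {s \<in> U. lam s = l}"
    have "q * (h\<^sup>2 * (h - 2)) \<le> (q - 1) * card W" using le cardU by (simp add: W_def)
    also have "\<dots> \<le> q * card W" by (rule mult_right_mono) auto
    finally have W_ge: "h\<^sup>2 * (h - 2) \<le> card W" using q_pos by simp
    have W_T: "W \<subseteq> T" by (auto simp: W_def U_def)
    have W_graph: "\<phi> ` W \<subseteq> graph l"
    proof (intro image_subsetI)
      fix s assume s: "s \<in> W"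
      obtain p c i i' where ss: "s = ((p, c), i, i')" by (metis prod.collapse)
      have "int q dvd (int (X (p, c) i') - int (X (p, c) i)) - int l * int p"
        using lam(2)[of "(p, c)" i i'] s W_T by (auto simp: ss W_def)
      then show "\<phi> s \<in> graph l"
        using s W_T X1 X2 unfolding ss \<phi>_def prod.case by (intro chord_in_graph) (auto simp: T_def)
    qed
    define apex where "apex = (\<lambda>(a :: nat \<times> nat, i :: nat, i' :: nat). enc (Line (fst a) (snd a)))"
    have point: "q\<^sup>2 \<le> z" if "z \<in> chord a x x'" for z a x x'
      using that by (auto simp: chord_def split: prod.splits)
    have apex_less: "apex s < q\<^sup>2" if "s \<in> T" for s
    proof -
      obtain p c i i' where ss: "s = ((p, c), i, i')" by (metis prod.collapse)
      then have "valid (Line p c)" using that by (auto simp: T_def lines_def)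
      then have "enc (Line p c) < q\<^sup>2" using enc_bounds(2) by blast
      then show ?thesis by (simp add: ss apex_def)
    qed
    have "card W div 2 \<le> game_value n (complete_graph 3) ?F Constructor C1 B1"
    proof (rule claim_indexed_triangles[where \<phi> = \<phi> and a = apex])
      show "C1 \<subseteq> ?K" using C1_graph graph_complete by blast
      show "\<phi> ` W \<subseteq> ?K - (C1 \<union> B1)"
      proof (intro image_subsetI)
        fix s assume s: "s \<in> W"
        have "\<phi> s \<in> ?K" using W_graph graph_complete s by blast
        moreover have "\<phi> s \<notin> B1" using s by (auto simp: W_def U_def)
        moreover have "\<phi> s \<notin> C1"
        proof
          assume "\<phi> s \<in> C1"
          then obtain a x where a: "a \<in> lines" "\<phi> s = flag a x" by (auto simp: C1_def J_def pair_def)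
          obtain p c where pc: "a = (p, c)" by fastforce
          have "enc (Line p c) \<in> \<phi> s" using a pc by (simp add: flag_def)
          then have "q\<^sup>2 \<le> enc (Line p c)" using point by (auto simp: \<phi>_def split: prod.splits)
          moreover have "valid (Line p c)" using a pc by (auto simp: lines_def)
          then have "enc (Line p c) < q\<^sup>2" using enc_bounds(2) by blast
          ultimately show False by linarith
        qed
        ultimately show "\<phi> s \<in> ?K - (C1 \<union> B1)" by blast
      qed
      show "free_of ?F ({..<n}, C1 \<union> \<phi> ` W)"
        by (rule free_of_mono[OF graph_free[OF nd1[OF l]]]) (use C1_graph W_graph in auto)
      show "finite B1" by (rule B1(1))
      show "inj_on \<phi> W" by (rule inj_on_subset[OF inj_\<phi> W_T])
      show "inj_on (\<lambda>s. insert (apex s) (\<phi> s)) W"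
      proof (rule inj_onI)
        fix s s' assume s: "s \<in> W" "s' \<in> W" and eq: "insert (apex s) (\<phi> s) = insert (apex s') (\<phi> s')"
        \<comment> \<open>Lines are encoded below \<open>q\<^sup>2\<close> and points above, so the chord can be recovered from the triangle.\<close>
        have "\<phi> r = {z \<in> insert (apex r) (\<phi> r). q\<^sup>2 \<le> z}" if "r \<in> W" for r
          using apex_less[of r] that W_T point by (auto simp: \<phi>_def split: prod.splits)
        then have "\<phi> s = \<phi> s'" using s eq by metis
        then show "s = s'" using inj_onD[OF inj_\<phi>] s W_T by blast
      qed
      fix s assume s: "s \<in> W"
      then have sT: "s \<in> T" using W_T by blast
      obtain p c i i' where ss: "s = ((p, c), i, i')" by (metis prod.collapse)
      let ?a = "(p, c)"
      let ?L = "enc (Line p c)" and ?P = "enc (Point (X ?a i) (height p c (X ?a i)))"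
        and ?P' = "enc (Point (X ?a i') (height p c (X ?a i')))"
      have i: "?a \<in> lines" "i < h" "h \<le> i'" "i' < 2 * h" using sT by (auto simp: ss T_def)
      have "{?L, ?P} \<in> C1" "{?L, ?P'} \<in> C1"
        using C1_flag[OF i(1), of i] C1_flag[OF i(1), of i'] i by (auto simp: flag_def)
      moreover have phi: "\<phi> s = {?P, ?P'}" by (simp add: ss \<phi>_def chord_def)
      moreover have "?P \<noteq> ?P'"
      proof
        assume "?P = ?P'"
        moreover have "valid (Point (X ?a i) (height p c (X ?a i)))" "valid (Point (X ?a i') (height p c (X ?a i')))"
          using X1[OF i(2), of ?a] X2[OF i(3,4), of ?a] height_less by auto
        ultimately have "X ?a i = X ?a i'" using enc_inject by blast
        then show False using X1[OF i(2), of ?a] X2[OF i(3,4), of ?a] by simp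
      qed
      moreover have "?L \<noteq> ?P" "?L \<noteq> ?P'"
        using apex_less[OF sT] by (auto simp: ss apex_def)
      ultimately show "insert (apex s) (\<phi> s) \<in> triangles (insert (\<phi> s) C1)"
        by (simp add: apex_def ss insert_in_triangles_iff)
    qed
    moreover have "t \<le> card W div 2" using W_ge unfolding t_def by (rule div_le_mono)
    ultimately show "t \<le> game_value n (complete_graph 3) ?F Constructor ({} \<union> (\<lambda>x. pair (x, \<sigma> x)) ` J) B1"
      by (simp add: C1_def)
  qed
  then have "t \<le> g_num n (complete_graph 3) ?F" by (simp add: g_num_def)
  moreover have "h ^ 3 \<le> 8 * t"
  proof -
    have "h \<le> 2 * (h - 2)" using h4 by simp
    then have "h\<^sup>2 * h \<le> h\<^sup>2 * (2 * (h - 2))" by (rule mult_left_mono) simp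
    then have a: "h ^ 3 \<le> 2 * (h\<^sup>2 * (h - 2))" by (simp add: power3_eq_cube power2_eq_square)
    have "4 * (4 * 4) \<le> h * (h * h)" using h4 by (intro mult_le_mono)
    then have "8 \<le> h ^ 3" by (simp add: power3_eq_cube)
    then show ?thesis using a unfolding t_def by linarith
  qed
  ultimately show ?thesis by linarith
qed

end

section \<open>The value of the triangle game\<close>

text \<open>With \<open>n\<close> of order \<open>q\<^sup>2\<close> both sides are of order \<open>q\<^sup>3\<close>.\<close>
lemma ex_num_le_g_num_of_eq_2:
  assumes n: "50 * 4 ^ 10 \<le> n"
  shows "ex_num n (even_cycles_upto 2) \<le> 3000000 * g_num n (complete_graph 3) (cycle_graph 4)"
proof -
  define j where "j = (LEAST j. n < 50 * 4 ^ Suc j)"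
  have "n < 50 * 4 ^ Suc n"
    by (rule less_le_trans[OF less_exp[of n]]) (auto intro: order.trans[OF power_mono[of 2 4 n]])
  then have upper: "n < 50 * 4 ^ Suc j" unfolding j_def by (rule LeastI)
  have j10: "10 \<le> j"
  proof (rule ccontr)
    assume "\<not> 10 \<le> j"
    then have "(4 :: nat) ^ Suc j \<le> 4 ^ 10" by (intro power_increasing) auto
    then show False using upper n by linarith
  qed
  have lower: "50 * 4 ^ j \<le> n"
  proof -
    have "\<not> n < 50 * 4 ^ Suc (j - 1)"
      unfolding j_def by (rule not_less_Least) (use j10 j_def in linarith)
    then show ?thesis using j10 by simp
  qed
  obtain q :: nat where q: "prime q" "2 ^ j < q" "q \<le> 4 * 2 ^ j + 1" using prime_between_pow2[OF j10] by blast
  have pow: "(2 ^ j)\<^sup>2 = (4 :: nat) ^ j" by (simp add: power2_eq_square flip: power_mult_distrib)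
  have j_pow: "(2 :: nat) ^ 10 \<le> 2 ^ j" using j10 by (intro power_increasing) auto
  have "(2 :: nat) ^ 10 = 1024" by simp
  then have q_large: "1024 < q" using q(2) j_pow by linarith
  have "q \<le> 5 * 2 ^ j" using q(3) j_pow by simp
  then have "q\<^sup>2 \<le> (5 * 2 ^ j)\<^sup>2" by (rule power_mono) simp
  then have fits: "2 * q\<^sup>2 \<le> n" using lower pow by (simp add: power_mult_distrib)
  have "(2 ^ j)\<^sup>2 \<le> q\<^sup>2" using q(2) by (intro power_mono) auto
  then have dense: "n \<le> 200 * q\<^sup>2" using upper pow by simp
  define h where "h = q div 4"
  have "\<not> 4 dvd q"
  proof
    assume "4 dvd q"
    then have "2 dvd q" by (rule dvd_trans[rotated]) simp
    then show False using q(1) q_large primes_dvd_imp_eq[of 2 q] two_is_prime_nat by auto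
  qed
  then have "q mod 4 \<noteq> 0" by (simp add: dvd_eq_mod_eq_0)
  moreover have "4 * h + q mod 4 = q" by (simp add: h_def)
  moreover have "q mod 4 < 4" by simp
  ultimately have hq: "4 * h < q" "q \<le> 5 * h" "4 \<le> h"
    using q_large by linarith+
  interpret plane q h n by unfold_locales (use q hq fits in auto)
  define g where "g = g_num n (complete_graph 3) (cycle_graph 4)"
  have g: "h ^ 3 \<le> 8 * g" unfolding g_def by (rule cube_le_g_num[OF hq(3)])
  have "q ^ 3 \<le> (5 * h) ^ 3" using hq(2) by (rule power_mono) simp
  then have q3: "q ^ 3 \<le> 1000 * g" using g by (simp add: power_mult_distrib)
  have "even_cycles_upto 2 = {cycle_graph 4}"
  proof -
    have "(\<lambda>i. cycle_graph (2 * i)) ` {i. 2 \<le> i \<and> i \<le> 2} = {cycle_graph 4}"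
    proof -
      have "{i :: nat. 2 \<le> i \<and> i \<le> 2} = {2}" by auto
      then show ?thesis by simp
    qed
    then show ?thesis by (auto simp: even_cycles_upto_def)
  qed
  moreover have "free_of (cycle_graph 4) ({..<n}, {})" by (rule free_of_cycle_empty) simp
  ultimately obtain E where E: "E \<subseteq> edges (complete_graph n)" "free_of (cycle_graph 4) ({..<n}, E)"
    "card E = ex_num n (even_cycles_upto 2)"
    using ex_num_attained[of "{cycle_graph 4}" n] by (metis singletonI singletonD)
  have "(card E)\<^sup>2 \<le> n ^ 3" by (rule card_squared_le_of_C4_free[OF E(1,2)])
  also have "\<dots> \<le> (200 * q\<^sup>2) ^ 3" using dense by (rule power_mono) simp
  also have "\<dots> \<le> (3000 * q ^ 3)\<^sup>2" by (simp add: power_mult_distrib flip: power_mult)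
  finally have "card E \<le> 3000 * q ^ 3" by (rule power2_le_imp_le) simp
  then show ?thesis using q3 E(3) by (simp add: g_def)
qed

theorem theorem1p3:
  fixes k :: nat
  assumes "k \<ge> 2"
  shows "\<exists>c C :: real. c > 0 \<and> C > 0 \<and> (\<exists>n0 :: nat. \<forall>n\<ge>n0.
           c * real (ex_num n (even_cycles_upto k))
             \<le> real (g_num n (complete_graph 3) (cycle_graph (2 * k))) \<and>
           real (g_num n (complete_graph 3) (cycle_graph (2 * k)))
             \<le> C * real (ex_num n {cycle_graph (2 * k)}))"
proof -
  let ?g = "\<lambda>n. g_num n (complete_graph 3) (cycle_graph (2 * k))"
  have lower: "ex_num n (even_cycles_upto k) \<le> 3000000 * ?g n" if n: "50 * 4 ^ 10 \<le> n" for n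
  proof (cases "k = 2")
    case True
    then show ?thesis using ex_num_le_g_num_of_eq_2[OF n] by simp
  next
    case False
    then have "ex_num n (even_cycles_upto k) \<le> 73728 * ?g n"
      using assms n by (intro ex_num_le_g_num_of_ge_3) auto
    then show ?thesis by simp
  qed
  show ?thesis
  proof (intro exI conjI allI impI)
    show "(1 / 3000000 :: real) > 0" "real (4 * k) > 0" using assms by auto
    fix n :: nat assume n: "50 * 4 ^ 10 \<le> n"
    have "real (ex_num n (even_cycles_upto k)) \<le> real (3000000 * ?g n)"
      using lower[OF n] by (simp only: of_nat_le_iff)
    then show "1 / 3000000 * real (ex_num n (even_cycles_upto k)) \<le> real (?g n)" by simp
    have "real (?g n) \<le> real (4 * k * ex_num n {cycle_graph (2 * k)})"
      using g_num_triangle_le[OF assms, of n] by (simp only: of_nat_le_iff)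
    then show "real (?g n) \<le> real (4 * k) * real (ex_num n {cycle_graph (2 * k)})" by simp
  qed
qed

end
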